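(* Let $C\subset\mathbb R^d$ be a nonempty compact set, let $\{\varphi_i\}_{i=1}^{\kappa}$ be a similitude iterated function system on $\mathbb R^d$ satisfying the condensation open set condition with condensation $C$, and let $E_C$ be the inhomogeneous self-similar set with condensation $C$. If the associated self-similar set $E$ is such that $\overline{\dim}_{\mathrm A}(C)<\overline{\dim}_{\mathrm A}(E)$, then $$\overline{\dim}_{\mathrm A}(E_C)<\overline{\dim}_{\mathrm{reg}}(\mu)$$ for all measures $\mu$ supported on $E_C$.
   Context: A similitude iterated function system (IFS) is a finite collection $\{\varphi_i\}_{i=1}^\kappa$ of contractive similitudes of $\mathbb R^d$. The associated self-similar set is the unique nonempty compact set $E\subset\mathbb R^d$ with $E=\bigcup_{i=1}^\kappa\varphi_i(E)$. For a compact set $C\subset\mathbb R^d$, the inhomogeneous self-similar set with condensation $C$ is the unique nonempty compact set $E_C\subset\mathbb R^d$ with $E_C=\bigcup_{i=1}^\kappa\varphi_i(E_C)\cup C$. Condensation open set condition (COSC) with condensation $C$: there exists a nonempty open set $U\subset\mathbb R^d$ such that $C\subset U\setminus\bigcup_i\overline{\varphi_i(U)}$, $\varphi_i(U)\subset U$ for all $i$, and $\varphi_i(U)\cap\varphi_j(U)=\emptyset$ whenever $i\ne j$. (Upper) Assouad dimension $\overline{\dim}_{\mathrm A}(A)$ of a set $A\subset\mathbb R^d$, regarded as a metric space with the restricted metric: the infimum of all $s\ge0$ for which there is a constant $c\ge1$ such that for all $x\in A$ and $0<r<R<\operatorname{diam}(A)$ the closed ball $B(x,R)$ of $A$ can be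 covered by at most $c(r/R)^{-s}$ balls of radius $r$. (For a one-point set the restriction $R<\operatorname{diam}(A)$ is removed.) Measure on a metric space $X$ (here $X=E_C$ with the restricted Euclidean metric): a nontrivial Borel regular outer measure for which bounded sets have finite measure. It is supported on $X$ if its support is all of $X$, i.e. every closed ball of positive radius centered in $X$ has positive measure. Upper regularity dimension $\overline{\dim}_{\mathrm{reg}}(\mu)$ of a measure $\mu$ supported on $X$: the infimum of all $s>0$ for which there is a constant $c>0$ such that $\frac{\mu(B(x,r))}{\mu(B(x,R))}\ge c\left(\frac rR\right)^s$ for all $x\in X$ and $0<r<R<\operatorname{diam}(X)$; it equals $\infty$ if no such $s$ exists (in particular if $\mu$ is not doubling). *)

theory Defs
  imports "HOL-Analysis.Analysis"
begin

definition contractive_similitude :: "('a::metric_space \<Rightarrow> 'a) \<Rightarrow> bool" where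
  "contractive_similitude f \<longleftrightarrow>
     (\<exists>\<rho>. 0 < \<rho> \<and> \<rho> < 1 \<and> (\<forall>x y. dist (f x) (f y) = \<rho> * dist x y))"

definition similitude_ifs :: "nat \<Rightarrow> (nat \<Rightarrow> 'a::metric_space \<Rightarrow> 'a) \<Rightarrow> bool" where
  "similitude_ifs \<kappa> \<phi> \<longleftrightarrow> (\<forall>i\<in>{1..\<kappa>}. contractive_similitude (\<phi> i))"

(* For contractive similitudes of a complete space such an E exists (if \<kappa> \<ge> 1) and is unique,
   so this predicate pins down the self-similar set; likewise for the inhomogeneous one below. *)
definition self_similar_set ::
    "nat \<Rightarrow> (nat \<Rightarrow> 'a::metric_space \<Rightarrow> 'a) \<Rightarrow> 'a set \<Rightarrow> bool" where
  "self_similar_set \<kappa> \<phi> E \<longleftrightarrow>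
     E \<noteq> {} \<and> compact E \<and> E = (\<Union>i\<in>{1..\<kappa>}. \<phi> i ` E)"

definition inhomogeneous_self_similar_set ::
    "nat \<Rightarrow> (nat \<Rightarrow> 'a::metric_space \<Rightarrow> 'a) \<Rightarrow> 'a set \<Rightarrow> 'a set \<Rightarrow> bool" where
  "inhomogeneous_self_similar_set \<kappa> \<phi> C E\<^sub>C \<longleftrightarrow>
     E\<^sub>C \<noteq> {} \<and> compact E\<^sub>C \<and> E\<^sub>C = (\<Union>i\<in>{1..\<kappa>}. \<phi> i ` E\<^sub>C) \<union> C"

definition condensation_open_set_condition ::
    "nat \<Rightarrow> (nat \<Rightarrow> 'a::metric_space \<Rightarrow> 'a) \<Rightarrow> 'a set \<Rightarrow> bool" where
  "condensation_open_set_condition \<kappa> \<phi> C \<longleftrightarrow>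
     (\<exists>U. open U \<and> U \<noteq> {} \<and>
        C \<subseteq> U - (\<Union>i\<in>{1..\<kappa>}. closure (\<phi> i ` U)) \<and>
        (\<forall>i\<in>{1..\<kappa>}. \<phi> i ` U \<subseteq> U) \<and>
        (\<forall>i\<in>{1..\<kappa>}. \<forall>j\<in>{1..\<kappa>}. i \<noteq> j \<longrightarrow> \<phi> i ` U \<inter> \<phi> j ` U = {}))"

(* The library's diameter is a junk value on unbounded sets, whose diameter is infinite. *)
definition below_diameter :: "real \<Rightarrow> 'a::metric_space set \<Rightarrow> bool" where
  "below_diameter R A \<longleftrightarrow> (bounded A \<longrightarrow> R < diameter A)"

(* Balls are those of the subspace A: centred in A and intersected with A.
   The value is infinite if no exponent s is admissible. *)
definition upper_assouad_dim :: "'a::metric_space set \<Rightarrow> ereal" where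
  "upper_assouad_dim A =
     Inf (ereal ` {s. 0 \<le> s \<and>
       (\<exists>c\<ge>1. \<forall>x\<in>A. \<forall>r R. 0 < r \<and> r < R \<and> (is_singleton A \<or> below_diameter R A) \<longrightarrow>
          (\<exists>T\<subseteq>A. finite T \<and> real (card T) \<le> c * (r / R) powr (- s) \<and>
             A \<inter> cball x R \<subseteq> (\<Union>y\<in>T. A \<inter> cball y r)))})"

(* A measure on the subspace X is an outer measure; only its values on subsets of X matter.
   outer_measure_space asks for countable subadditivity on disjoint sequences, which with
   monotonicity on Pow X gives it for all sequences.
   lambda_system X (Pow X) \<mu> is the collection of its Caratheodory measurable sets. *)
definition measure_on :: "'a::metric_space set \<Rightarrow> ('a set \<Rightarrow> ennreal) \<Rightarrow> bool" where
  "measure_on X \<mu> \<longleftrightarrow>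
     outer_measure_space (Pow X) \<mu> \<and>
     \<mu> X \<noteq> 0 \<and>
     sets (restrict_space borel X) \<subseteq> lambda_system X (Pow X) \<mu> \<and>
     (\<forall>A\<subseteq>X. \<exists>B\<in>sets (restrict_space borel X). A \<subseteq> B \<and> \<mu> A = \<mu> B) \<and>
     (\<forall>A\<subseteq>X. bounded A \<longrightarrow> \<mu> A < \<infinity>)"

definition measure_supported_on :: "'a::metric_space set \<Rightarrow> ('a set \<Rightarrow> ennreal) \<Rightarrow> bool" where
  "measure_supported_on X \<mu> \<longleftrightarrow>
     measure_on X \<mu> \<and> (\<forall>x\<in>X. \<forall>r>0. 0 < \<mu> (X \<inter> cball x r))"

definition upper_regularity_dim ::
    "'a::metric_space set \<Rightarrow> ('a set \<Rightarrow> ennreal) \<Rightarrow> ereal" where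
  "upper_regularity_dim X \<mu> =
     Inf (ereal ` {s. 0 < s \<and>
       (\<exists>c>0. \<forall>x\<in>X. \<forall>r R. 0 < r \<and> r < R \<and> below_diameter R X \<longrightarrow>
          \<mu> (X \<inter> cball x r) / \<mu> (X \<inter> cball x R) \<ge> ennreal (c * (r / R) powr s))})"

end

theory Submission
  imports Defs
begin

text \<open>
  Let \<open>q(s) = \<Sum>\<^sub>i \<rho>\<^sub>i\<^sup>s\<close>, where the \<open>\<rho>\<^sub>i\<close> are the contraction ratios. Two facts are combined.

  Upper bound: if \<open>q(s) < 1\<close> then \<open>s\<close> is an admissible covering exponent for \<open>E\<close>, and also for
  \<open>E\<^sub>C\<close> as soon as \<open>C\<close> has an admissible exponent at most \<open>s\<close>. At scale \<open>R\<close>, the set is covered by the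
  pieces \<open>\<phi>\<^sub>w(E\<^sub>C)\<close> of size about \<open>R\<close> and the larger copies \<open>\<phi>\<^sub>w(C)\<close>. Distinct copies of \<open>C\<close> satisfy
  \<open>dist(\<phi>\<^sub>v(C), \<phi>\<^sub>w(C)) \<ge> \<delta> max(\<rho>\<^sub>v, \<rho>\<^sub>w)\<close>, so only boundedly many of all these sets meet a ball of
  radius \<open>R\<close>, and \<open>\<Sum>\<^sub>w \<rho>\<^sub>w\<^sup>s = 1 / (1 - q(s))\<close> controls the finer covers.

  Lower bound: a lower regular measure gives the gap \<open>\<phi>\<^sub>w(U) - \<Union>\<^sub>i \<phi>\<^sub>w\<^sub>i(U)\<close>, which contains a ball
  around a point of \<open>\<phi>\<^sub>w(C)\<close>, at least a fixed proportion \<open>\<eta>\<close> of the mass of \<open>\<phi>\<^sub>w(U)\<close>. Hence the total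
  mass of generation \<open>n\<close> decays like \<open>(1 - \<eta>)\<^sup>n\<close>, while \<open>t\<close>-regularity bounds it below by a multiple
  of \<open>q(t)\<^sup>n\<close>. Thus \<open>q(t) \<le> 1 - \<eta>\<close> uniformly in the admissible \<open>t\<close>, so that \<open>q(t - \<epsilon>) < 1\<close> for
  some \<open>\<epsilon> > 0\<close> independent of \<open>t\<close>.
\<close>

section \<open>Covering exponents\<close>

text \<open>Covers by sets of small diameter involve no centres, so they restrict to subsets, join
  under unions and rescale exactly under similitudes. The bound \<open>N\<close> is real so that
  powers can stand there without rounding.\<close>

definition coverable :: "'a::metric_space set \<Rightarrow> real \<Rightarrow> real \<Rightarrow> bool" where
  "coverable A r N \<longleftrightarrow>
     (\<exists>F. finite F \<and> real (card F) \<le> N \<and> A \<subseteq> \<Union>F \<and> (\<forall>S\<in>F. \<forall>x\<in>S. \<forall>y\<in>S. dist x y \<le> r))"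

lemma coverable_mono:
  assumes "coverable A r N" "B \<subseteq> A" "r \<le> r'" "N \<le> N'"
  shows "coverable B r' N'"
proof -
  obtain F where F: "finite F" "real (card F) \<le> N" "A \<subseteq> \<Union>F" "\<forall>S\<in>F. \<forall>x\<in>S. \<forall>y\<in>S. dist x y \<le> r"
    using assms(1) unfolding coverable_def by blast
  have "real (card F) \<le> N'" "B \<subseteq> \<Union>F" using F(2,3) assms(2,4) by (linarith, blast)
  moreover have "\<forall>S\<in>F. \<forall>x\<in>S. \<forall>y\<in>S. dist x y \<le> r'"
    using F(4) assms(3) order_trans by blast
  ultimately show ?thesis
    unfolding coverable_def using F(1) by (intro exI[of _ F] conjI)
qed

lemma coverable_empty: "0 \<le> N \<Longrightarrow> coverable {} r N"
  unfolding coverable_def by (intro exI[of _ "{}"]) auto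

lemma coverable_single:
  assumes "\<And>x y. x \<in> A \<Longrightarrow> y \<in> A \<Longrightarrow> dist x y \<le> r"
  shows "coverable A r 1"
  unfolding coverable_def using assms by (intro exI[of _ "{A}"]) auto

lemma coverable_Un:
  assumes "coverable A r M" "coverable B r N"
  shows "coverable (A \<union> B) r (M + N)"
proof -
  obtain F where F: "finite F" "real (card F) \<le> M" "A \<subseteq> \<Union>F"
    "\<forall>S\<in>F. \<forall>x\<in>S. \<forall>y\<in>S. dist x y \<le> r"
    using assms(1) unfolding coverable_def by blast
  obtain G where G: "finite G" "real (card G) \<le> N" "B \<subseteq> \<Union>G"
    "\<forall>S\<in>G. \<forall>x\<in>S. \<forall>y\<in>S. dist x y \<le> r"
    using assms(2) unfolding coverable_def by blast
  have "real (card (F \<union> G)) \<le> M + N"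
    using card_Un_le[of F G] F(2) G(2) by linarith
  moreover have "A \<union> B \<subseteq> \<Union>(F \<union> G)" using F(3) G(3) by blast
  moreover have "\<forall>S\<in>F \<union> G. \<forall>x\<in>S. \<forall>y\<in>S. dist x y \<le> r" using F(4) G(4) by blast
  ultimately show ?thesis
    unfolding coverable_def using F(1) G(1) by (intro exI[of _ "F \<union> G"] conjI finite_UnI)
qed

lemma coverable_UN:
  assumes "finite I" "\<And>i. i \<in> I \<Longrightarrow> coverable (A i) r (N i)"
  shows "coverable (\<Union>i\<in>I. A i) r (\<Sum>i\<in>I. N i)"
  using assms
proof (induction I rule: finite_induct)
  case (insert i I)
  then have "coverable (A i \<union> (\<Union>i\<in>I. A i)) r (N i + (\<Sum>i\<in>I. N i))"
    by (intro coverable_Un) simp_all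
  then show ?case using insert.hyps by simp
qed (simp add: coverable_empty)

lemma coverable_image:
  assumes "coverable A r N" "\<And>x y. dist (f x) (f y) = k * dist x y" "0 \<le> k"
  shows "coverable (f ` A) (k * r) N"
proof -
  obtain F where F: "finite F" "real (card F) \<le> N" "A \<subseteq> \<Union>F" "\<forall>S\<in>F. \<forall>x\<in>S. \<forall>y\<in>S. dist x y \<le> r"
    using assms(1) unfolding coverable_def by auto
  have "real (card ((`) f ` F)) \<le> N"
    using F(1,2) card_image_le[of F "(`) f"] by linarith
  moreover have "f ` A \<subseteq> \<Union>((`) f ` F)" using F(3) by blast
  ultimately show ?thesis
    unfolding coverable_def using F(1,4) assms(2,3)
    by (intro exI[of _ "(`) f ` F"]) (auto intro!: mult_left_mono)
qed

lemma balls_imp_coverable: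
  assumes "finite T" "real (card T) \<le> N" "A \<subseteq> (\<Union>y\<in>T. cball y r)"
  shows "coverable A (2 * r) N"
proof -
  have "dist x z \<le> 2 * r" if "x \<in> cball y r" "z \<in> cball y r" for x y z :: 'a
    using that dist_triangle2[of x z y] by (simp add: dist_commute)
  then have "\<forall>S\<in>(\<lambda>y. cball y r) ` T. \<forall>x\<in>S. \<forall>z\<in>S. dist x z \<le> 2 * r" by blast
  moreover have "real (card ((\<lambda>y. cball y r) ` T)) \<le> N"
    using assms(1,2) card_image_le[of T "\<lambda>y. cball y r"] by linarith
  ultimately show ?thesis
    unfolding coverable_def using assms(1,3)
    by (intro exI[of _ "(\<lambda>y. cball y r) ` T"] conjI) auto
qed

text \<open>Each covering set that meets \<open>A\<close> lies in the ball of the same radius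
  \<open>r\<close> about any of its points in \<open>A\<close>. Centres can thus be placed in
  \<open>A\<close> without enlarging the radius.\<close>

lemma coverable_imp_balls:
  assumes "coverable (A \<inter> B) r N"
  shows "\<exists>T\<subseteq>A. finite T \<and> real (card T) \<le> N \<and> A \<inter> B \<subseteq> (\<Union>y\<in>T. A \<inter> cball y r)"
proof -
  obtain F where F: "finite F" "real (card F) \<le> N" "A \<inter> B \<subseteq> \<Union>F" "\<forall>S\<in>F. \<forall>x\<in>S. \<forall>y\<in>S. dist x y \<le> r"
    using assms(1) unfolding coverable_def by auto
  define G where "G = {S\<in>F. S \<inter> A \<noteq> {}}"
  define p where "p S = (SOME x. x \<in> S \<inter> A)" for S
  have p: "p S \<in> S \<inter> A" if "S \<in> G" for S
    using that unfolding p_def G_def by (simp add: some_in_eq del: Int_iff)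
  have fin: "finite G" and "card G \<le> card F"
    using F(1) by (auto simp: G_def intro: card_mono)
  then have "real (card (p ` G)) \<le> N"
    using F(2) card_image_le[OF fin, of p] by linarith
  moreover have "A \<inter> B \<subseteq> (\<Union>y\<in>p ` G. A \<inter> cball y r)"
  proof
    fix x assume x: "x \<in> A \<inter> B"
    then obtain S where "S \<in> F" "x \<in> S" using F(3) by auto
    then have "S \<in> G" using x by (auto simp: G_def)
    then show "x \<in> (\<Union>y\<in>p ` G. A \<inter> cball y r)"
      using p[of S] F(4) \<open>S \<in> F\<close> \<open>x \<in> S\<close> x by auto
  qed
  ultimately show ?thesis
    using p fin by (intro exI[of _ "p ` G"]) auto
qed

text \<open>The covering condition of the Assouad dimension with sets of small diameter in place of
  balls and with no upper bound on \<open>R\<close>. For compact sets the infimum over nonnegative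
  exponents stays the same, by \<open>upper_assouad_dim_le\<close> and
  \<open>upper_assouad_dim_less_imp\<close>.\<close>

definition covering_exponent :: "'a::metric_space set \<Rightarrow> real \<Rightarrow> bool" where
  "covering_exponent A s \<longleftrightarrow>
     (\<exists>c\<ge>1. \<forall>x\<in>A. \<forall>r R. 0 < r \<and> r < R \<longrightarrow> coverable (A \<inter> cball x R) r (c * (R / r) powr s))"

text \<open>By compactness finitely many balls of a fixed radius below \<open>R0\<close> cover
  \<open>A\<close>. For large \<open>R\<close> the local bound is used in each of them; if
  \<open>r\<close> is large too, the balls themselves are the cover.\<close>

lemma covering_exponent_extend:
  fixes A :: "'a::metric_space set"
  assumes A: "compact A" and "0 < R0" "1 \<le> c" "0 \<le> s"
    and loc: "\<And>x r R. \<lbrakk>x \<in> A; 0 < r; r < R; R < R0\<rbrakk> \<Longrightarrow>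
                coverable (A \<inter> cball x R) r (c * (R / r) powr s)"
  shows "covering_exponent A s"
proof -
  define h where "h = R0 / 2"
  have h: "0 < h" "h < R0" using \<open>0 < R0\<close> by (auto simp: h_def)
  have "A \<subseteq> (\<Union>y\<in>A. ball y (h / 2))" using h(1) by auto
  then obtain T where T: "T \<subseteq> A" "finite T" "A \<subseteq> (\<Union>y\<in>T. ball y (h / 2))"
    by (rule compactE_image[OF A open_ball])
  \<comment> \<open>One constant for three cases: \<open>c\<close> for \<open>R < R0\<close>,
    \<open>card T * c\<close> for large \<open>R\<close> and small \<open>r\<close>, and
    \<open>card T\<close> when both are large.\<close>
  define d where "d = c * (1 + real (card T))"
  have d: "c \<le> d" "real (card T) * c \<le> d" "real (card T) \<le> d" "1 \<le> d"
  proof -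
    show "c \<le> d" "real (card T) * c \<le> d"
      using \<open>1 \<le> c\<close> by (auto simp: d_def algebra_simps)
    then show "1 \<le> d" using \<open>1 \<le> c\<close> by linarith
    have "real (card T) * 1 \<le> real (card T) * c"
      using \<open>1 \<le> c\<close> by (intro mult_left_mono) auto
    then show "real (card T) \<le> d" using \<open>real (card T) * c \<le> d\<close> by linarith
  qed
  have "coverable (A \<inter> cball x R) r (d * (R / r) powr s)"
    if x: "x \<in> A" and r: "0 < r" "r < R" for x r R
  proof (cases "R < R0")
    case True
    then show ?thesis
      using coverable_mono[OF loc[OF x r]] d(1) by (simp add: mult_right_mono)
  next
    case False
    have one: "1 \<le> (R / r) powr s" using r \<open>0 \<le> s\<close> by (intro ge_one_powr_ge_zero) auto
    show ?thesis
    proof (cases "r < h")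
      case True
      have "coverable (\<Union>y\<in>T. A \<inter> cball y h) r (\<Sum>y\<in>T. c * (R / r) powr s)"
      proof (rule coverable_UN[OF T(2)])
        fix y assume "y \<in> T"
        then have "coverable (A \<inter> cball y h) r (c * (h / r) powr s)"
          using loc[of y r h] T(1) r h True by auto
        moreover have "c * (h / r) powr s \<le> c * (R / r) powr s"
          using \<open>1 \<le> c\<close> r h False \<open>0 \<le> s\<close>
          by (intro mult_left_mono powr_mono2 divide_right_mono) auto
        ultimately show "coverable (A \<inter> cball y h) r (c * (R / r) powr s)"
          by (rule coverable_mono[OF _ order_refl order_refl])
      qed
      moreover have "A \<inter> cball x R \<subseteq> (\<Union>y\<in>T. A \<inter> cball y h)"
      proof
        fix z assume "z \<in> A \<inter> cball x R"
        then have z: "z \<in> A" by simp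
        then have "z \<in> (\<Union>y\<in>T. ball y (h / 2))" by (rule subsetD[OF T(3)])
        then obtain y where y: "y \<in> T" "dist y z < h / 2" by auto
        then have "dist y z \<le> h" using h(1) by linarith
        then show "z \<in> (\<Union>y\<in>T. A \<inter> cball y h)" using y(1) z by (intro UN_I[of y]) simp_all
      qed
      moreover have "(\<Sum>y\<in>T. c * (R / r) powr s) \<le> d * (R / r) powr s"
        using mult_right_mono[OF d(2), of "(R / r) powr s"] by (simp add: mult.assoc)
      ultimately show ?thesis by (rule coverable_mono[OF _ _ order_refl])
    next
      case False
      have "A \<subseteq> (\<Union>y\<in>T. cball y (h / 2))"
        using T(3) UN_mono[OF order_refl ball_subset_cball] by (rule order_trans)
      then have "coverable A (2 * (h / 2)) d"
        by (rule balls_imp_coverable[OF T(2) d(3)])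
      moreover have "d * 1 \<le> d * (R / r) powr s"
        using d(4) one by (intro mult_left_mono) auto
      ultimately show ?thesis
        using False by - (rule coverable_mono[of A "2 * (h / 2)" d], simp_all)
    qed
  qed
  then show ?thesis
    unfolding covering_exponent_def using d(4) by (intro exI[of _ d] conjI allI ballI impI) auto
qed

lemma upper_assouad_dim_le:
  assumes "covering_exponent A s" "0 \<le> s"
  shows "upper_assouad_dim A \<le> ereal s"
proof -
  obtain c where c: "1 \<le> c"
    "\<And>x r R. \<lbrakk>x \<in> A; 0 < r; r < R\<rbrakk> \<Longrightarrow> coverable (A \<inter> cball x R) r (c * (R / r) powr s)"
    using assms(1) unfolding covering_exponent_def by blast
  have "\<exists>T\<subseteq>A. finite T \<and> real (card T) \<le> c * (r / R) powr (- s) \<and>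
          A \<inter> cball x R \<subseteq> (\<Union>y\<in>T. A \<inter> cball y r)" if "x \<in> A" "0 < r" "r < R" for x r R
  proof -
    have "(R / r) powr s = (r / R) powr (- s)"
      using that by (simp add: powr_minus powr_divide)
    then show ?thesis using coverable_imp_balls[OF c(2)[OF that]] by simp
  qed
  then show ?thesis
    unfolding upper_assouad_dim_def using c(1) assms(2)
    by (intro Inf_lower imageI CollectI conjI exI[of _ c]) auto
qed

text \<open>Balls of radius \<open>r / 2\<close> have diameter at most \<open>r\<close>, which costs
  the factor \<open>2 powr s\<close>. The restriction on \<open>R\<close> is then lifted by
  compactness.\<close>

lemma upper_assouad_dim_less_imp:
  assumes "compact A" "upper_assouad_dim A < ereal t"
  obtains s where "0 \<le> s" "s < t" "covering_exponent A s"
proof -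
  obtain s where s: "0 \<le> s" "s < t" and "\<exists>c\<ge>1. \<forall>x\<in>A. \<forall>r R. 0 < r \<and> r < R \<and> (is_singleton A \<or> below_diameter R A) \<longrightarrow>
          (\<exists>T\<subseteq>A. finite T \<and> real (card T) \<le> c * (r / R) powr (- s) \<and>
             A \<inter> cball x R \<subseteq> (\<Union>y\<in>T. A \<inter> cball y r))"
    using assms(2) unfolding upper_assouad_dim_def Inf_less_iff
    by (elim bexE imageE CollectE conjE) (metis less_ereal.simps(1))
  then obtain c where c: "1 \<le> c" and
    cov: "\<And>x r R. \<lbrakk>x \<in> A; 0 < r; r < R; is_singleton A \<or> below_diameter R A\<rbrakk> \<Longrightarrow>
            (\<exists>T\<subseteq>A. finite T \<and> real (card T) \<le> c * (r / R) powr (- s) \<and>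
               A \<inter> cball x R \<subseteq> (\<Union>y\<in>T. A \<inter> cball y r))"
    by meson
  have bdd: "bounded A" using assms(1) by (rule compact_imp_bounded)
  have loc: "coverable (A \<inter> cball x R) r (c * 2 powr s * (R / r) powr s)"
    if "x \<in> A" "0 < r" "r < R" "is_singleton A \<or> R < diameter A" for x r R
  proof -
    have small: "x \<in> A" "0 < r / 2" "r / 2 < R" "is_singleton A \<or> below_diameter R A"
      using that by (auto simp: below_diameter_def)
    obtain T where T: "T \<subseteq> A" "finite T" "real (card T) \<le> c * (r / 2 / R) powr (- s)"
      "A \<inter> cball x R \<subseteq> (\<Union>y\<in>T. A \<inter> cball y (r / 2))"
      using cov[of x "r / 2" R] small by blast
    have "(r / 2 / R) powr (- s) = 2 powr s * (R / r) powr s"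
      using that by (simp add: powr_minus powr_divide powr_mult field_simps)
    then show ?thesis
      using balls_imp_coverable[of T "c * (r / 2 / R) powr (- s)" "A \<inter> cball x R" "r / 2"] T
      by (simp add: mult.assoc subset_iff)
  qed
  have "1 \<le> (2::real) powr s" using s by (simp add: ge_one_powr_ge_zero)
  then have c': "1 \<le> c * 2 powr s" using mult_mono[of 1 c 1 "2 powr s"] c by simp
  have "covering_exponent A s"
  \<comment> \<open>For a singleton the definition leaves \<open>R\<close> unrestricted, so the
    local bound is already global. Otherwise the diameter is positive and serves as
    \<open>R0\<close>.\<close>
  proof (cases "A = {} \<or> is_singleton A")
    case True
    then show ?thesis
      unfolding covering_exponent_def using loc c'
      by (intro exI[of _ "c * 2 powr s"]) auto
  next
    case False
    then obtain x y where "x \<in> A" "y \<in> A" "x \<noteq> y"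
      using is_singletonI'[of A] by blast
    then have "0 < diameter A"
      using diameter_bounded_bound[OF bdd, of x y] zero_less_dist_iff[of x y] by linarith
    then show ?thesis
      by (rule covering_exponent_extend[OF assms(1) _ c' s(1)]) (use loc in auto)
  qed
  with s show thesis by (rule that)
qed

section \<open>Packing bound for separated points\<close>

text \<open>Rescaling by \<open>1 / R\<close> about \<open>x\<close> moves the points into the fixed
  ball \<open>cball 0 K\<close> and keeps them \<eta>-separated. Each ball of a finite \<eta>/2-net
  of that ball contains at most one of them, so the bound does not depend on the scale.\<close>

lemma separated_family_bound:
  assumes "0 < \<eta>"
  shows "\<exists>M::nat. \<forall>(f :: 'i \<Rightarrow> 'a::euclidean_space) I x R. 0 < R \<longrightarrow>
           (\<forall>i\<in>I. dist x (f i) \<le> K * R) \<longrightarrow>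
           (\<forall>i\<in>I. \<forall>j\<in>I. i \<noteq> j \<longrightarrow> \<eta> * R \<le> dist (f i) (f j)) \<longrightarrow>
           finite I \<and> card I \<le> M"
proof -
  obtain T :: "'a set" where T: "finite T" "cball 0 K \<subseteq> (\<Union>t\<in>T. ball t (\<eta> / 2))"
    using compact_cball[of "0::'a" K] assms
    unfolding compact_eq_totally_bounded by (meson half_gt_zero)
  have "finite I \<and> card I \<le> card T"
    if R: "0 < R" and near: "\<And>i. i \<in> I \<Longrightarrow> dist x (f i) \<le> K * R"
      and sep: "\<And>i j. \<lbrakk>i \<in> I; j \<in> I; i \<noteq> j\<rbrakk> \<Longrightarrow> \<eta> * R \<le> dist (f i) (f j)"
    for f :: "'i \<Rightarrow> 'a" and I x R
  proof -
    define g where "g i = (1 / R) *\<^sub>R (f i - x)" for i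
    have "\<exists>t\<in>T. dist t (g i) < \<eta> / 2" if "i \<in> I" for i
    proof -
      have "norm (f i - x) \<le> K * R" using near[OF that] by (simp add: dist_norm norm_minus_commute)
      then have "g i \<in> cball 0 K" using R by (simp add: g_def pos_divide_le_eq)
      then have "g i \<in> (\<Union>t\<in>T. ball t (\<eta> / 2))" using T(2) by blast
      then show ?thesis by (auto simp only: UN_iff mem_ball)
    qed
    then obtain p where p: "\<And>i. i \<in> I \<Longrightarrow> p i \<in> T" "\<And>i. i \<in> I \<Longrightarrow> dist (p i) (g i) < \<eta> / 2"
      by metis
    have "inj_on p I"
    proof (rule inj_onI, rule ccontr)
      fix i j assume ij: "i \<in> I" "j \<in> I" "p i = p j" "i \<noteq> j"
      have "dist (g i) (g j) < \<eta>"
        using p(2)[OF ij(1)] p(2)[OF ij(2)] ij(3) dist_triangle3[of "g i" "g j" "p i"] by simp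
      moreover have "g i - g j = (1 / R) *\<^sub>R (f i - f j)"
        by (simp add: g_def algebra_simps)
      then have "dist (g i) (g j) = dist (f i) (f j) / R"
        using R by (simp add: dist_norm)
      ultimately show False using sep[OF ij(1,2,4)] R by (simp add: field_simps)
    qed
    then show ?thesis
      using card_inj_on_le[of p I T] inj_on_finite[of p I T] T(1) p(1) by (simp add: image_subsetI)
  qed
  then show ?thesis by (intro exI[of _ "card T"] allI impI) blast
qed

section \<open>Regularity of measures\<close>

lemma measure_on_finite:
  assumes "measure_on X \<mu>" "bounded X"
  shows "\<mu> (X \<inter> A) < \<infinity>"
  using assms bounded_subset[of X "X \<inter> A"] by (simp add: measure_on_def)

lemma measure_on_mono:
  assumes "measure_on X \<mu>" "bounded X" "A \<subseteq> B"
  shows "enn2real (\<mu> (X \<inter> A)) \<le> enn2real (\<mu> (X \<inter> B))"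
proof (rule enn2real_mono)
  have "increasing (Pow X) \<mu>"
    using assms(1) by (simp add: measure_on_def outer_measure_space_def)
  then show "\<mu> (X \<inter> A) \<le> \<mu> (X \<inter> B)"
    by (rule increasingD) (use assms(3) in auto)
  show "\<mu> (X \<inter> B) < top"
    using measure_on_finite[OF assms(1,2)] by simp
qed

text \<open>The open set makes \<open>X \<inter> A\<close> Caratheodory measurable, and it splits
  the test set \<open>X \<inter> (A \<union> B)\<close>. Hence \<open>B\<close> is arbitrary; later
  it is, for instance, a closed ball.\<close>

lemma measure_on_additive:
  assumes m: "measure_on X \<mu>" "bounded X" and "open A" "A \<inter> B = {}"
  shows "enn2real (\<mu> (X \<inter> (A \<union> B))) = enn2real (\<mu> (X \<inter> A)) + enn2real (\<mu> (X \<inter> B))"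
proof -
  have "X \<inter> A \<in> sets (restrict_space borel X)"
    using \<open>open A\<close> by (simp add: sets_restrict_space)
  then have "X \<inter> A \<in> lambda_system X (Pow X) \<mu>"
    using m(1) unfolding measure_on_def by (elim conjE) (rule subsetD)
  then have "\<mu> (X \<inter> A \<inter> Y) + \<mu> ((X - X \<inter> A) \<inter> Y) = \<mu> Y" if "Y \<subseteq> X" for Y
    using that by (simp add: lambda_system_def)
  then have "\<mu> (X \<inter> A \<inter> (X \<inter> (A \<union> B))) + \<mu> ((X - X \<inter> A) \<inter> (X \<inter> (A \<union> B))) = \<mu> (X \<inter> (A \<union> B))"
    by (metis inf_le1)
  moreover have "X \<inter> A \<inter> (X \<inter> (A \<union> B)) = X \<inter> A" "(X - X \<inter> A) \<inter> (X \<inter> (A \<union> B)) = X \<inter> B"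
    using \<open>A \<inter> B = {}\<close> by auto
  ultimately have "\<mu> (X \<inter> (A \<union> B)) = \<mu> (X \<inter> A) + \<mu> (X \<inter> B)" by simp
  then show ?thesis
    using measure_on_finite[OF m] by (simp add: enn2real_plus)
qed

text \<open>The inequality of the upper regularity dimension with the division cleared. Balls are
  not cut down to \<open>X\<close> because \<open>m\<close> will be the restriction of the measure
  to \<open>X\<close>, and \<open>t\<close> may be any real number.\<close>

definition lower_regular :: "('a::metric_space set \<Rightarrow> real) \<Rightarrow> 'a set \<Rightarrow> real \<Rightarrow> bool" where
  "lower_regular m X t \<longleftrightarrow>
     (\<exists>c>0. \<forall>x\<in>X. \<forall>r R. 0 < r \<and> r < R \<and> R < diameter X \<longrightarrow>
        c * (r / R) powr t * m (cball x R) \<le> m (cball x r))"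

text \<open>Ball masses are finite since \<open>X\<close> is bounded, and positive since the support
  is all of \<open>X\<close>, so the extended quotient is an honest real one. If no exponent is
  lower regular, every \<open>s\<close> qualifies and the dimension is infinite.\<close>

lemma upper_regularity_dim_ge:
  assumes mu: "measure_supported_on X \<mu>" and "bounded X"
    and reg: "\<And>t. lower_regular (\<lambda>A. enn2real (\<mu> (X \<inter> A))) X t \<Longrightarrow> s \<le> t"
  shows "ereal s \<le> upper_regularity_dim X \<mu>"
  unfolding upper_regularity_dim_def
proof (intro Inf_greatest, elim imageE CollectE conjE exE)
  fix y t c
  assume y: "y = ereal t" and c: "0 < c" and lb:
    "\<forall>x\<in>X. \<forall>r R. 0 < r \<and> r < R \<and> below_diameter R X \<longrightarrow>
       \<mu> (X \<inter> cball x r) / \<mu> (X \<inter> cball x R) \<ge> ennreal (c * (r / R) powr t)"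
  have on: "measure_on X \<mu>" using mu by (simp add: measure_supported_on_def)
  have eq: "\<mu> (X \<inter> A) = ennreal (enn2real (\<mu> (X \<inter> A)))" for A
    using measure_on_finite[OF on \<open>bounded X\<close>, of A] by simp
  have "c * (r / R) powr t * enn2real (\<mu> (X \<inter> cball x R)) \<le> enn2real (\<mu> (X \<inter> cball x r))"
    if x: "x \<in> X" and r: "0 < r" "r < R" "R < diameter X" for x r R
  proof -
    define a where "a = enn2real (\<mu> (X \<inter> cball x r))"
    define b where "b = enn2real (\<mu> (X \<inter> cball x R))"
    have "0 < R" using r by linarith
    then have "0 < \<mu> (X \<inter> cball x R)"
      using mu x by (simp add: measure_supported_on_def)
    then have b: "0 < b" using eq[of "cball x R"] by (simp add: b_def enn2real_positive_iff measure_on_finite[OF on \<open>bounded X\<close>, simplified])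
    have "ennreal (c * (r / R) powr t) \<le> ennreal a / ennreal b"
      using lb x r unfolding a_def b_def eq[symmetric] by (simp add: below_diameter_def)
    also have "\<dots> = ennreal (a / b)" using b by (simp add: divide_ennreal a_def)
    finally have "c * (r / R) powr t \<le> a / b" by (simp add: a_def b_def)
    then show ?thesis using b by (simp add: pos_le_divide_eq a_def b_def)
  qed
  then have "lower_regular (\<lambda>A. enn2real (\<mu> (X \<inter> A))) X t"
    unfolding lower_regular_def using c by (intro exI[of _ c] conjI ballI allI impI) auto
  then show "ereal s \<le> y" using reg y by simp
qed

section \<open>Copies of the condensation set\<close>

text \<open>Subtracting the value at 0 and dividing by the ratio gives an isometry fixing 0, which
  is an orthogonal transformation and hence onto.\<close>

lemma similitude_surj:
  fixes f :: "'a::euclidean_space \<Rightarrow> 'a"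
  assumes "\<And>x y. dist (f x) (f y) = k * dist x y" "0 < k"
  shows "surj f"
proof -
  define g where "g x = (1 / k) *\<^sub>R (f x - f 0)" for x
  have "dist (g x) (g y) = dist x y" for x y
  proof -
    have "g x - g y = (1 / k) *\<^sub>R (f x - f y)" by (simp add: g_def algebra_simps)
    then show ?thesis
      using assms(2) assms(1)[of x y] by (simp add: dist_norm)
  qed
  then have "orthogonal_transformation g"
    by (simp add: orthogonal_transformation_isometry g_def)
  then have "surj g" by (rule orthogonal_transformation_surj)
  show ?thesis
  proof (rule surjI)
    fix y
    define z where "z = inv g ((1 / k) *\<^sub>R (y - f 0))"
    have "g z = (1 / k) *\<^sub>R (y - f 0)"
      using \<open>surj g\<close> by (simp add: z_def surj_f_inv_f)
    then show "f (inv g ((1 / k) *\<^sub>R (y - f 0))) = y"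
      using assms(2) by (simp add: g_def z_def)
  qed
qed

lemma similitude_ball_subset:
  fixes f :: "'a::euclidean_space \<Rightarrow> 'a"
  assumes f: "\<And>x y. dist (f x) (f y) = k * dist x y" and k: "0 < k"
  shows "ball (f x) (k * e) \<subseteq> f ` ball x e"
proof
  fix y assume y: "y \<in> ball (f x) (k * e)"
  obtain z where "y = f z" using similitude_surj[OF f k] by blast
  then have "dist x z < e" using y f[of x z] k by simp
  then show "y \<in> f ` ball x e" using \<open>y = f z\<close> by simp
qed

lemma open_similitude_image:
  fixes f :: "'a::euclidean_space \<Rightarrow> 'a"
  assumes f: "\<And>x y. dist (f x) (f y) = k * dist x y" and k: "0 < k" and "open V"
  shows "open (f ` V)"
  unfolding open_contains_ball
proof
  fix y assume "y \<in> f ` V"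
  then obtain x where x: "x \<in> V" "y = f x" by auto
  then obtain e where "0 < e" "ball x e \<subseteq> V" using openE[OF \<open>open V\<close>] by metis
  then have "0 < k * e" using k by simp
  moreover have "ball y (k * e) \<subseteq> f ` V"
    using similitude_ball_subset[OF f k, of x e] image_mono[OF \<open>ball x e \<subseteq> V\<close>, of f] x(2)
    by (metis order_trans)
  ultimately show "\<exists>e>0. ball y e \<subseteq> f ` V" by (intro exI[of _ "k * e"] conjI)
qed

primrec word_map :: "('i \<Rightarrow> 'a \<Rightarrow> 'a) \<Rightarrow> 'i list \<Rightarrow> 'a \<Rightarrow> 'a" where
  "word_map \<phi> [] = id"
| "word_map \<phi> (i # w) = \<phi> i \<circ> word_map \<phi> w"

lemma word_map_append: "word_map \<phi> (u @ v) = word_map \<phi> u \<circ> word_map \<phi> v"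
  by (induction u) (auto simp: comp_assoc)

text \<open>The condensation open set condition with the ratios and the open set fixed, and with a
  bounded \<open>U\<close>. That \<open>U\<close> can be chosen bounded is shown in
  \<open>cosc_ifs_exists\<close>.\<close>

locale cosc_ifs =
  fixes \<kappa> :: nat and \<phi> :: "nat \<Rightarrow> 'a::euclidean_space \<Rightarrow> 'a" and \<rho> :: "nat \<Rightarrow> real"
    and C U :: "'a set"
  assumes \<kappa>_pos: "1 \<le> \<kappa>"
    and \<rho>_pos: "i \<in> {1..\<kappa>} \<Longrightarrow> 0 < \<rho> i" and \<rho>_less: "i \<in> {1..\<kappa>} \<Longrightarrow> \<rho> i < 1"
    and dist_\<phi>: "i \<in> {1..\<kappa>} \<Longrightarrow> dist (\<phi> i x) (\<phi> i y) = \<rho> i * dist x y"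
    and compact_C: "compact C" and C_nonempty: "C \<noteq> {}"
    and open_U: "open U" and bounded_U: "bounded U"
    and C_subset: "C \<subseteq> U - (\<Union>i\<in>{1..\<kappa>}. closure (\<phi> i ` U))"
    and \<phi>_U: "i \<in> {1..\<kappa>} \<Longrightarrow> \<phi> i ` U \<subseteq> U"
    and \<phi>_disjoint: "\<lbrakk>i \<in> {1..\<kappa>}; j \<in> {1..\<kappa>}; i \<noteq> j\<rbrakk> \<Longrightarrow> \<phi> i ` U \<inter> \<phi> j ` U = {}"
begin

abbreviation words :: "nat list set" where "words \<equiv> lists {1..\<kappa>}"

abbreviation \<psi> :: "nat list \<Rightarrow> 'a \<Rightarrow> 'a" where "\<psi> \<equiv> word_map \<phi>"

abbreviation ratio :: "nat list \<Rightarrow> real" where "ratio w \<equiv> prod_list (map \<rho> w)"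

text \<open>The gap that the first-generation pieces leave in \<open>U\<close>. Its images under the
  maps \<open>\<psi> w\<close> are pairwise disjoint neighbourhoods of the copies of
  \<open>C\<close>.\<close>

definition W :: "'a set" where "W = U - (\<Union>i\<in>{1..\<kappa>}. closure (\<phi> i ` U))"

definition \<rho>_min :: real where "\<rho>_min = Min (\<rho> ` {1..\<kappa>})"

definition \<rho>_max :: real where "\<rho>_max = Max (\<rho> ` {1..\<kappa>})"

text \<open>The function called q in the introductory text; \<open>pressure s = 1\<close> is the
  Moran equation.\<close>

definition pressure :: "real \<Rightarrow> real" where "pressure s = (\<Sum>i\<in>{1..\<kappa>}. \<rho> i powr s)"

lemma \<rho>_min: "0 < \<rho>_min" "\<rho>_min < 1" "i \<in> {1..\<kappa>} \<Longrightarrow> \<rho>_min \<le> \<rho> i"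
proof -
  have "\<rho>_min \<in> \<rho> ` {1..\<kappa>}"
    unfolding \<rho>_min_def using \<kappa>_pos by (intro Min_in) auto
  then show "0 < \<rho>_min" "\<rho>_min < 1" using \<rho>_pos \<rho>_less by auto
  show "i \<in> {1..\<kappa>} \<Longrightarrow> \<rho>_min \<le> \<rho> i" unfolding \<rho>_min_def by (intro Min_le) auto
qed

lemma \<rho>_max: "0 < \<rho>_max" "\<rho>_max < 1" "i \<in> {1..\<kappa>} \<Longrightarrow> \<rho> i \<le> \<rho>_max"
proof -
  have "\<rho>_max \<in> \<rho> ` {1..\<kappa>}"
    unfolding \<rho>_max_def using \<kappa>_pos by (intro Max_in) auto
  then show "0 < \<rho>_max" "\<rho>_max < 1" using \<rho>_pos \<rho>_less by auto
  show "i \<in> {1..\<kappa>} \<Longrightarrow> \<rho> i \<le> \<rho>_max" unfolding \<rho>_max_def by (intro Max_ge) auto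
qed

lemma ratio_pos: "w \<in> words \<Longrightarrow> 0 < ratio w"
  by (induction w) (auto intro!: mult_pos_pos \<rho>_pos)

lemma dist_\<psi>: "w \<in> words \<Longrightarrow> dist (\<psi> w x) (\<psi> w y) = ratio w * dist x y"
  by (induction w) (auto simp: dist_\<phi>)

lemma inj_\<psi>: "w \<in> words \<Longrightarrow> inj (\<psi> w)"
  using dist_\<psi> ratio_pos by (intro injI) (metis dist_eq_0_iff mult_eq_0_iff less_irrefl)

lemma \<psi>_U: "w \<in> words \<Longrightarrow> \<psi> w ` U \<subseteq> U"
proof (induction w)
  case (Cons i w)
  then have "\<phi> i ` \<psi> w ` U \<subseteq> \<phi> i ` U" "\<phi> i ` U \<subseteq> U"
    using \<phi>_U by (auto simp del: image_subset_iff intro: image_mono)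
  then show ?case by (auto simp: image_comp)
qed simp

lemma open_\<psi>_U: "w \<in> words \<Longrightarrow> open (\<psi> w ` U)"
  by (rule open_similitude_image[OF dist_\<psi> ratio_pos open_U])

lemma open_W: "open W"
  unfolding W_def by (intro open_Diff open_U closed_UN) auto

lemma W_subset: "W \<subseteq> U" and W_disjoint: "i \<in> {1..\<kappa>} \<Longrightarrow> W \<inter> \<phi> i ` U = {}"
proof -
  show "W \<subseteq> U" by (auto simp: W_def)
  show "i \<in> {1..\<kappa>} \<Longrightarrow> W \<inter> \<phi> i ` U = {}"
    using closure_subset[of "\<phi> i ` U"] unfolding W_def by blast
qed

lemma C_subset_W: "C \<subseteq> W"
  using C_subset by (simp add: W_def)

text \<open>A common first letter cancels by injectivity. If the first letters differ, the images
  lie in disjoint pieces of \<open>U\<close>; if one word is exhausted, the other image lies in a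
  first-generation piece, which \<open>W\<close> avoids.\<close>

lemma \<psi>_W_disjoint:
  assumes "v \<in> words" "w \<in> words" "v \<noteq> w"
  shows "\<psi> v ` W \<inter> \<psi> w ` W = {}"
  using assms
proof (induction v arbitrary: w)
  case Nil
  then obtain j w' where w: "w = j # w'" "j \<in> {1..\<kappa>}" "w' \<in> words" by (cases w) auto
  then have "\<psi> w ` W \<subseteq> \<phi> j ` U" using \<psi>_U[of w'] W_subset by fastforce
  then show ?case using W_disjoint[OF w(2)] by auto
next
  case (Cons i v)
  then have i: "i \<in> {1..\<kappa>}" "v \<in> words" by auto
  have iU: "\<psi> (i # v) ` W \<subseteq> \<phi> i ` U" using \<psi>_U[OF i(2)] W_subset by fastforce
  show ?case
  proof (cases w)
    case Nil
    then show ?thesis using iU W_disjoint[OF i(1)] by auto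
  next
    case (Cons j w')
    then have j: "j \<in> {1..\<kappa>}" "w' \<in> words" using Cons.prems by auto
    have jU: "\<psi> w ` W \<subseteq> \<phi> j ` U" using \<psi>_U[OF j(2)] W_subset Cons by fastforce
    show ?thesis
    proof (cases "i = j")
      case True
      then have "\<psi> v ` W \<inter> \<psi> w' ` W = {}"
        using Cons.IH[of w'] Cons.prems \<open>w = j # w'\<close> i j by auto
      moreover have "inj (\<phi> i)" using inj_\<psi>[of "[i]"] i by simp
      ultimately have "\<phi> i ` (\<psi> v ` W) \<inter> \<phi> i ` (\<psi> w' ` W) = {}"
        by (metis image_Int image_empty)
      then show ?thesis using True \<open>w = j # w'\<close> by (simp add: image_comp)
    next
      case False
      then show ?thesis using iU jU \<phi>_disjoint[OF i(1) j(1)] by blast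
    qed
  qed
qed

text \<open>A \<delta>-neighbourhood of the compact set \<open>C\<close> lies in \<open>W\<close>.
  Its image under \<open>\<psi> v\<close> contains balls of radius \<open>\<delta> * ratio v\<close>
  about the points of that copy and misses all other copies. Exchanging \<open>v\<close> and
  \<open>w\<close> gives the same bound with the other ratio.\<close>

lemma inner_radius:
  shows "\<exists>\<delta>>0. (\<forall>x\<in>C. cball x \<delta> \<subseteq> W) \<and>
    (\<forall>x\<in>C. \<forall>y\<in>C. \<forall>v\<in>words. \<forall>w\<in>words. v \<noteq> w \<longrightarrow> \<delta> * ratio v \<le> dist (\<psi> v x) (\<psi> w y))"
proof -
  obtain \<delta> where \<delta>: "0 < \<delta>" "(\<Union>x\<in>C. cball x \<delta>) \<subseteq> W"
    using compact_subset_open_imp_cball_epsilon_subset[OF compact_C open_W C_subset_W] by blast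
  have "\<delta> * ratio v \<le> dist (\<psi> v x) (\<psi> w y)"
    if "x \<in> C" "y \<in> C" "v \<in> words" "w \<in> words" "v \<noteq> w" for x y v w
  proof (rule ccontr)
    assume "\<not> ?thesis"
    then have "\<psi> w y \<in> ball (\<psi> v x) (ratio v * \<delta>)" by (simp add: mult.commute)
    also have "\<dots> \<subseteq> \<psi> v ` ball x \<delta>"
      by (rule similitude_ball_subset[OF dist_\<psi> ratio_pos]) (use that in auto)
    also have "\<dots> \<subseteq> \<psi> v ` W"
      using \<delta>(2) that(1) ball_subset_cball by blast
    finally show False
      using \<psi>_W_disjoint[OF that(3-5)] C_subset_W that(2) by blast
  qed
  moreover have "\<forall>x\<in>C. cball x \<delta> \<subseteq> W" using \<delta>(2) by blast
  ultimately show ?thesis using \<delta>(1) by (intro exI[of _ \<delta>]) simp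
qed

section \<open>Sums over words and decomposition at a given scale\<close>

text \<open>Splitting off the first letter, the sum over words of length at most n + 1 is 1 plus
  \<open>pressure s\<close> times the sum for n. The bound is the fixed point of this
  recursion.\<close>

lemma sum_ratio_powr_le:
  assumes "pressure s < 1" "finite F" "F \<subseteq> words"
  shows "(\<Sum>w\<in>F. ratio w powr s) \<le> 1 / (1 - pressure s)"
proof -
  have p0: "0 \<le> pressure s" unfolding pressure_def by (intro sum_nonneg) auto
  define L where "L n = {w. set w \<subseteq> {1..\<kappa>} \<and> length w \<le> n}" for n
  have fin: "finite (L n)" for n unfolding L_def by (rule finite_lists_length_le) auto
  have pos: "0 \<le> ratio w powr s" for w by simp
  have "(\<Sum>w\<in>L n. ratio w powr s) \<le> 1 / (1 - pressure s)" for n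
  proof (induction n)
    case 0
    have "L 0 = {[]}" by (auto simp: L_def)
    then show ?case using assms(1) p0 by (simp add: field_simps)
  next
    case (Suc n)
    have L: "L (Suc n) = insert [] ((\<lambda>(i, w). i # w) ` ({1..\<kappa>} \<times> L n))"
    proof (intro set_eqI iffI)
      fix w assume "w \<in> L (Suc n)"
      then show "w \<in> insert [] ((\<lambda>(i, w). i # w) ` ({1..\<kappa>} \<times> L n))"
        by (cases w) (auto simp: L_def image_iff)
    qed (auto simp: L_def)
    have inj: "inj_on (\<lambda>(i, w). i # w) ({1..\<kappa>} \<times> L n)" by (auto simp: inj_on_def)
    have "(\<Sum>w\<in>L (Suc n). ratio w powr s)
        = 1 + (\<Sum>w\<in>(\<lambda>(i, w). i # w) ` ({1..\<kappa>} \<times> L n). ratio w powr s)"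
      unfolding L using fin[of n] by (subst sum.insert) auto
    also have "(\<Sum>w\<in>(\<lambda>(i, w). i # w) ` ({1..\<kappa>} \<times> L n). ratio w powr s)
        = (\<Sum>(i, w)\<in>{1..\<kappa>} \<times> L n. \<rho> i powr s * ratio w powr s)"
      by (subst sum.reindex[OF inj])
        (auto intro!: sum.cong simp: L_def in_lists_conv_set \<rho>_pos less_imp_le ratio_pos powr_mult subset_iff)
    also have "\<dots> = pressure s * (\<Sum>w\<in>L n. ratio w powr s)"
      by (simp add: pressure_def sum_product sum.cartesian_product)
    also have "\<dots> \<le> pressure s * (1 / (1 - pressure s))"
      by (intro mult_left_mono Suc.IH p0)
    also have "1 + \<dots> = 1 / (1 - pressure s)" using assms(1) by (simp add: field_simps)
    finally show ?case by simp
  qed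
  moreover have "\<exists>n. F \<subseteq> L n"
  proof
    show "F \<subseteq> L (Max (length ` F))"
      using assms(2,3) by (auto simp: L_def)
  qed
  ultimately show ?thesis
    by (meson fin order_trans pos sum_mono2)
qed

lemma finite_large_words:
  assumes "0 < e"
  shows "finite {w \<in> words. e \<le> ratio w}"
proof -
  obtain n where n: "\<rho>_max ^ n < e"
    using real_arch_pow_inv[OF assms \<rho>_max(2)] by blast
  have le: "ratio w \<le> \<rho>_max ^ length w" if "w \<in> words" for w
    using that
  proof (induction w)
    case (Cons i w)
    then show ?case
      using \<rho>_max(3)[of i] \<rho>_max(1) ratio_pos[of w] \<rho>_pos[of i]
      by (auto intro!: mult_mono)
  qed simp
  have "length w \<le> n" if "w \<in> words" "e \<le> ratio w" for w
  proof (rule ccontr)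
    assume "\<not> length w \<le> n"
    then have "\<rho>_max ^ length w \<le> \<rho>_max ^ n"
      using \<rho>_max by (intro power_decreasing) auto
    then show False using le[OF that(1)] that(2) n by linarith
  qed
  then have "{w \<in> words. e \<le> ratio w} \<subseteq> {w. set w \<subseteq> {1..\<kappa>} \<and> length w \<le> n}" by auto
  then show ?thesis
    by (rule finite_subset) (rule finite_lists_length_le, simp)
qed

text \<open>Refine the address of a point while its ratio exceeds \<open>R\<close>. Either the point
  falls into a copy of \<open>P\<close> on the way, or the ratio first drops to at most
  \<open>R\<close>, and the last letter costs a factor of at least
  \<open>\<rho>_min\<close>.\<close>

lemma scale_decomposition:
  assumes X: "X \<subseteq> (\<Union>i\<in>{1..\<kappa>}. \<phi> i ` X) \<union> P" and R: "0 < R" "R < 1"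
  shows "X \<subseteq> (\<Union>w\<in>{w\<in>words. \<rho>_min * R \<le> ratio w \<and> ratio w \<le> R}. \<psi> w ` X)
           \<union> (\<Union>w\<in>{w\<in>words. R < ratio w}. \<psi> w ` P)" (is "_ \<subseteq> ?D")
proof -
  obtain n where n: "\<rho>_max ^ n < R"
    using real_arch_pow_inv[OF R(1) \<rho>_max(2)] by blast
  \<comment> \<open>Here \<open>n\<close> bounds the remaining refinements: each letter uses up one
    factor \<open>\<rho>_max\<close>, and for \<open>n = 0\<close> the two bounds on the ratio
    contradict each other.\<close>
  have "\<psi> w ` X \<subseteq> ?D" if "w \<in> words" "R < ratio w" "ratio w * \<rho>_max ^ n \<le> R" for w n
    using that
  proof (induction n arbitrary: w)
    case (Suc n)
    show ?case
    proof
      fix y assume "y \<in> \<psi> w ` X"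
      then obtain x where x: "x \<in> X" "y = \<psi> w x" by auto
      consider "x \<in> P" | i z where "i \<in> {1..\<kappa>}" "z \<in> X" "x = \<phi> i z" using X x(1) by auto
      then show "y \<in> ?D"
      proof cases
        case 1
        then show ?thesis using Suc.prems x(2) by blast
      next
        case 2
        have w': "w @ [i] \<in> words" using 2(1) Suc.prems(1) by auto
        have y: "y = \<psi> (w @ [i]) z" using x(2) 2(3) by (simp add: word_map_append)
        have r: "ratio (w @ [i]) = ratio w * \<rho> i" by simp
        have "0 < ratio w" using Suc.prems(1) by (rule ratio_pos)
        then have *: "ratio w * \<rho> i \<le> ratio w * \<rho>_max"
          using \<rho>_max(3)[OF 2(1)] by simp
        show ?thesis
        proof (cases "R < ratio (w @ [i])")
          case True
          have "ratio w * \<rho> i * \<rho>_max ^ n \<le> ratio w * \<rho>_max * \<rho>_max ^ n"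
            using * \<rho>_max(1) by (intro mult_right_mono) auto
          also have "\<dots> \<le> R" using Suc.prems(3) by (simp add: mult.assoc)
          finally have "\<psi> (w @ [i]) ` X \<subseteq> ?D"
            using True by (intro Suc.IH w') (simp_all add: r)
          then show ?thesis using y 2(2) by blast
        next
          case False
          have "\<rho>_min * R \<le> \<rho> i * ratio w"
            using \<rho>_min(1) \<rho>_min(3)[OF 2(1)] Suc.prems(2) R by (intro mult_mono) auto
          then have "w @ [i] \<in> {w\<in>words. \<rho>_min * R \<le> ratio w \<and> ratio w \<le> R}"
            using False w' by (simp add: mult.commute)
          then show ?thesis using y 2(2) by blast
        qed
      qed
    qed
  qed auto
  from this[of "[]" n] n R show ?thesis by auto
qed

section \<open>Covering exponents of attractors\<close>

text \<open>Decompose at scale \<open>t\<close>: a piece of ratio at most \<open>t\<close> is a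
  single set of the cover, and a larger copy of \<open>P\<close> is covered by a rescaled cover of
  \<open>P\<close>. Each count is at most a constant times
  \<open>ratio w powr s * t powr (- s)\<close>, which is summable over all words.\<close>

lemma attractor_global_cover:
  assumes X: "X \<subseteq> (\<Union>i\<in>{1..\<kappa>}. \<phi> i ` X) \<union> P"
    and P: "covering_exponent P a" and "a \<le> s" "0 \<le> s" and p: "pressure s < 1"
    and D: "1 \<le> D" "\<forall>x\<in>X. \<forall>y\<in>X. dist x y \<le> D" "\<forall>x\<in>P. \<forall>y\<in>P. dist x y \<le> D"
  shows "\<exists>K\<ge>1. \<forall>t. 0 < t \<longrightarrow> t < 1 \<longrightarrow> coverable X (D * t) (K * t powr (- s))"
proof -
  obtain c where c: "1 \<le> c"
    "\<And>x r R. \<lbrakk>x \<in> P; 0 < r; r < R\<rbrakk> \<Longrightarrow> coverable (P \<inter> cball x R) r (c * (R / r) powr a)"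
    using P unfolding covering_exponent_def by auto
  define Q where "Q = 1 / (1 - pressure s)"
  define K where "K = max 1 ((\<rho>_min powr (- s) + c) * Q)"
  have "coverable X (D * t) (K * t powr (- s))" if t: "0 < t" "t < 1" for t
  proof -
    define A where "A = {w\<in>words. \<rho>_min * t \<le> ratio w \<and> ratio w \<le> t}"
    define B where "B = {w\<in>words. t < ratio w}"
    have mt: "0 < \<rho>_min * t" using \<rho>_min(1) t(1) by simp
    have "finite A"
      unfolding A_def by (rule finite_subset[OF _ finite_large_words[OF mt]]) auto
    have "finite B"
      unfolding B_def by (rule finite_subset[OF _ finite_large_words[OF t(1)]]) auto
    have "coverable (\<psi> w ` X) (D * t) 1" if "w \<in> A" for w
    proof (rule coverable_single)
      fix x y assume "x \<in> \<psi> w ` X" "y \<in> \<psi> w ` X"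
      then obtain x' y' where xy: "x' \<in> X" "y' \<in> X" "x = \<psi> w x'" "y = \<psi> w y'" by blast
      have w: "w \<in> words" "ratio w \<le> t" using that by (auto simp: A_def)
      have "ratio w * dist x' y' \<le> t * D"
        using w ratio_pos[OF w(1)] D(2) xy(1,2) t by (intro mult_mono) auto
      then show "dist x y \<le> D * t" using dist_\<psi>[OF w(1)] xy by (simp add: mult.commute)
    qed
    then have cA: "coverable (\<Union>w\<in>A. \<psi> w ` X) (D * t) (\<Sum>w\<in>A. 1)"
      by (rule coverable_UN[OF \<open>finite A\<close>])
    have "coverable (\<psi> v ` P) (D * t) (c * (ratio v powr s * t powr (- s)))" if "v \<in> B" for v
    proof (cases "P = {}")
      case True
      then show ?thesis using c(1) by (simp add: coverable_empty)
    next
      case False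
      then obtain y where y: "y \<in> P" by auto
      have v: "v \<in> words" "t < ratio v" using that by (auto simp: B_def)
      have r0: "0 < ratio v" by (rule ratio_pos[OF v(1)])
      have tr: "0 < t / ratio v" "t / ratio v < 1" using t v r0 by auto
      have "coverable (P \<inter> cball y D) (D * (t / ratio v)) (c * (D / (D * (t / ratio v))) powr a)"
        using D(1) mult_pos_pos[OF _ tr(1), of D] mult_strict_left_mono[OF tr(2), of D]
        by (intro c(2)[OF y]) linarith+
      moreover have "P \<inter> cball y D = P" using D(3) y by auto
      moreover have "D / (D * (t / ratio v)) = ratio v / t" using D(1) by simp
      ultimately have "coverable P (D * (t / ratio v)) (c * (ratio v / t) powr a)" by simp
      then have "coverable (\<psi> v ` P) (ratio v * (D * (t / ratio v))) (c * (ratio v / t) powr a)"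
        by (rule coverable_image[OF _ dist_\<psi>[OF v(1)]]) (use r0 in simp)
      moreover have "ratio v * (D * (t / ratio v)) = D * t" using r0 by simp
      moreover have "c * (ratio v / t) powr a \<le> c * (ratio v powr s * t powr (- s))"
      proof -
        have "(ratio v / t) powr a \<le> (ratio v / t) powr s"
          using v(2) t \<open>a \<le> s\<close> by (intro powr_mono) auto
        also have "\<dots> = ratio v powr s * t powr (- s)"
          using t r0 by (simp add: powr_divide powr_minus_divide)
        finally show ?thesis using c(1) by simp
      qed
      ultimately show ?thesis using coverable_mono[OF _ order_refl order_refl] by simp
    qed
    then have cB: "coverable (\<Union>w\<in>B. \<psi> w ` P) (D * t)
        (\<Sum>w\<in>B. c * (ratio w powr s * t powr (- s)))"
      by (rule coverable_UN[OF \<open>finite B\<close>])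
    have sub: "X \<subseteq> (\<Union>w\<in>A. \<psi> w ` X) \<union> (\<Union>w\<in>B. \<psi> w ` P)"
      unfolding A_def B_def by (rule scale_decomposition[OF X t])
    \<comment> \<open>Words in \<open>A\<close> have ratio at least \<open>\<rho>_min * t\<close>,
      which turns the number of pieces into a power sum.\<close>
    have "(\<Sum>w\<in>A. 1) \<le> (\<Sum>w\<in>A. ratio w powr s * (\<rho>_min powr (- s) * t powr (- s)))"
    proof (rule sum_mono)
      fix w assume "w \<in> A"
      then have w: "w \<in> words" "\<rho>_min * t \<le> ratio w" by (auto simp: A_def)
      have "(\<rho>_min * t) powr s \<le> ratio w powr s"
        using w mt \<open>0 \<le> s\<close> by (intro powr_mono2) auto
      then have "1 \<le> ratio w powr s * (\<rho>_min * t) powr (- s)"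
        using powr_gt_zero[of "\<rho>_min * t" s] mt
        by (simp only: powr_minus_divide times_divide_eq_right mult_1_right le_divide_eq_1_pos)
      also have "(\<rho>_min * t) powr (- s) = \<rho>_min powr (- s) * t powr (- s)"
        using \<rho>_min(1) t(1) by (simp add: powr_mult)
      finally show "1 \<le> ratio w powr s * (\<rho>_min powr (- s) * t powr (- s))" .
    qed
    also have "\<dots> = (\<Sum>w\<in>A. ratio w powr s) * (\<rho>_min powr (- s) * t powr (- s))"
      by (simp add: sum_distrib_right)
    also have "\<dots> \<le> Q * (\<rho>_min powr (- s) * t powr (- s))"
      unfolding Q_def
      by (intro mult_right_mono sum_ratio_powr_le[OF p \<open>finite A\<close>]) (auto simp: A_def)
    finally have sA: "(\<Sum>w\<in>A. 1) \<le> Q * (\<rho>_min powr (- s) * t powr (- s))" .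
    have "(\<Sum>w\<in>B. c * (ratio w powr s * t powr (- s)))
        = (\<Sum>w\<in>B. ratio w powr s) * (c * t powr (- s))"
      by (simp add: sum_distrib_left sum_distrib_right mult_ac)
    also have "\<dots> \<le> Q * (c * t powr (- s))"
      unfolding Q_def using c(1)
      by (intro mult_right_mono sum_ratio_powr_le[OF p \<open>finite B\<close>]) (auto simp: B_def)
    finally have "(\<Sum>w\<in>A. 1) + (\<Sum>w\<in>B. c * (ratio w powr s * t powr (- s)))
        \<le> Q * (\<rho>_min powr (- s) * t powr (- s)) + Q * (c * t powr (- s))"
      using sA by linarith
    also have "\<dots> = ((\<rho>_min powr (- s) + c) * Q) * t powr (- s)"
      by (simp add: algebra_simps)
    also have "\<dots> \<le> K * t powr (- s)"
      unfolding K_def by (intro mult_right_mono) auto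
    finally show ?thesis
      by (rule coverable_mono[OF coverable_Un[OF cA cB] sub order_refl])
  qed
  moreover have "1 \<le> K" by (simp add: K_def)
  ultimately show ?thesis by (intro exI[of _ K] conjI allI impI)
qed

text \<open>With \<open>P = {}\<close> this serves the self-similar set, with \<open>P = C\<close>
  the inhomogeneous one. Boundedly many pieces and copies meet a ball of radius \<open>R\<close>;
  the pieces are covered by the global estimate and the copies by the local estimate for
  \<open>P\<close>. The reference points \<open>\<psi> w x0\<close> come from \<open>C\<close>, so
  they exist also when \<open>P\<close> is empty.\<close>

lemma attractor_covering_exponent:
  assumes "compact X" and X: "X = (\<Union>i\<in>{1..\<kappa>}. \<phi> i ` X) \<union> P"
    and "P \<subseteq> C" and P: "covering_exponent P a" and "a \<le> s" "0 \<le> s" and p: "pressure s < 1"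
  shows "covering_exponent X s"
proof -
  obtain x0 where x0: "x0 \<in> C" using C_nonempty by auto
  obtain \<delta> where \<delta>: "0 < \<delta>" and
    "\<forall>x\<in>C. \<forall>y\<in>C. \<forall>v\<in>words. \<forall>w\<in>words. v \<noteq> w \<longrightarrow> \<delta> * ratio v \<le> dist (\<psi> v x) (\<psi> w y)"
    using inner_radius by (elim exE conjE)
  then have sep: "\<delta> * ratio v \<le> dist (\<psi> v x) (\<psi> w y)"
    if "x \<in> C" "y \<in> C" "v \<in> words" "w \<in> words" "v \<noteq> w" for x y v w
    using that by simp
  have "bounded (X \<union> C)"
    using \<open>compact X\<close> compact_C by (simp add: compact_imp_bounded)
  then obtain D0 where D0: "\<And>x y. \<lbrakk>x \<in> X \<union> C; y \<in> X \<union> C\<rbrakk> \<Longrightarrow> dist x y \<le> D0"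
    unfolding bounded_two_points by metis
  define D where "D = max 1 D0"
  have D1: "1 \<le> D" by (simp add: D_def)
  have D: "dist x y \<le> D" if "x \<in> X \<union> C" "y \<in> X \<union> C" for x y
    using D0[OF that] by (simp add: D_def)
  have DX: "\<forall>x\<in>X. \<forall>y\<in>X. dist x y \<le> D" and DP: "\<forall>x\<in>P. \<forall>y\<in>P. dist x y \<le> D"
    using D \<open>P \<subseteq> C\<close> by (simp_all add: subset_iff)
  have X': "X \<subseteq> (\<Union>i\<in>{1..\<kappa>}. \<phi> i ` X) \<union> P" using X by simp
  obtain K where K: "1 \<le> K"
    "\<forall>t. 0 < t \<longrightarrow> t < 1 \<longrightarrow> coverable X (D * t) (K * t powr (- s))"
    using attractor_global_cover[OF X' P \<open>a \<le> s\<close> \<open>0 \<le> s\<close> p D1 DX DP] by (elim exE conjE)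
  obtain c where c: "1 \<le> c"
    "\<And>x r R. \<lbrakk>x \<in> P; 0 < r; r < R\<rbrakk> \<Longrightarrow> coverable (P \<inter> cball x R) r (c * (R / r) powr a)"
    using P unfolding covering_exponent_def by auto
  have "0 < \<delta> * \<rho>_min" using \<delta> \<rho>_min(1) by simp
  \<comment> \<open>\<open>M1\<close> bounds the number of pieces of ratio between
    \<open>\<rho>_min * R\<close> and \<open>R\<close>: their reference points lie within
    \<open>(1 + D) * R\<close> of the centre.\<close>
  obtain M1 :: nat where M1: "\<forall>(f :: nat list \<Rightarrow> 'a) I x R. 0 < R \<longrightarrow>
      (\<forall>i\<in>I. dist x (f i) \<le> (1 + D) * R) \<longrightarrow>
      (\<forall>i\<in>I. \<forall>j\<in>I. i \<noteq> j \<longrightarrow> \<delta> * \<rho>_min * R \<le> dist (f i) (f j)) \<longrightarrow>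
      finite I \<and> card I \<le> M1"
    using separated_family_bound[where K = "1 + D", OF \<open>0 < \<delta> * \<rho>_min\<close>] by (elim exE)
  \<comment> \<open>\<open>M2\<close> bounds the number of copies of \<open>P\<close> of ratio
    between \<open>R\<close> and \<open>2 / \<delta> * R\<close>. Above this threshold the
    separation of copies exceeds the diameter \<open>2 * R\<close> of the ball.\<close>
  obtain M2 :: nat where M2: "\<forall>(f :: nat list \<Rightarrow> 'a) I x R. 0 < R \<longrightarrow>
      (\<forall>i\<in>I. dist x (f i) \<le> (1 + 2 / \<delta> * D) * R) \<longrightarrow>
      (\<forall>i\<in>I. \<forall>j\<in>I. i \<noteq> j \<longrightarrow> \<delta> * R \<le> dist (f i) (f j)) \<longrightarrow>
      finite I \<and> card I \<le> M2"
    using separated_family_bound[where K = "1 + 2 / \<delta> * D", OF \<delta>] by (elim exE)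
  \<comment> \<open>The 1 in \<open>M2 + 1\<close> is for a single larger copy of \<open>P\<close>.
    \<open>D powr s\<close> arises as \<open>X\<close> is covered at the relative scale
    \<open>r / (R * D)\<close>, and \<open>2 powr s\<close> as the ball is recentred in the copy
    with radius \<open>2 * R\<close>.\<close>
  define H where "H = max 1 (real M1 * (K * D powr s) + real (M2 + 1) * (c * 2 powr s))"
  have loc: "coverable (X \<inter> cball x R) r (H * (R / r) powr s)"
    if x: "x \<in> X" and r: "0 < r" "r < R" and R: "R < 1" for x r R
  proof -
    have "0 < R" using r by linarith
    then have mR: "0 < \<rho>_min * R" using \<rho>_min(1) by simp
    define A where "A = {w\<in>words. \<rho>_min * R \<le> ratio w \<and> ratio w \<le> R \<and> \<psi> w ` X \<inter> cball x R \<noteq> {}}"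
    define B where "B = {w\<in>words. R < ratio w \<and> \<psi> w ` P \<inter> cball x R \<noteq> {}}"
    have near: "dist x (\<psi> w x0) \<le> R + ratio w * D"
      if w: "w \<in> words" and Y: "Y \<subseteq> X \<union> C" "\<psi> w ` Y \<inter> cball x R \<noteq> {}" for w Y
    proof -
      obtain y where y: "y \<in> Y" "dist x (\<psi> w y) \<le> R" using Y(2) by auto
      have "dist (\<psi> w y) (\<psi> w x0) = ratio w * dist y x0" by (rule dist_\<psi>[OF w])
      also have "\<dots> \<le> ratio w * D"
        using y(1) Y(1) x0 ratio_pos[OF w] by (intro mult_left_mono D) auto
      finally show ?thesis using y(2) dist_triangle[of x "\<psi> w x0" "\<psi> w y"] by linarith
    qed
    have A: "finite A \<and> card A \<le> M1"
    proof (rule M1[rule_format, OF \<open>0 < R\<close>, where f = "\<lambda>w. \<psi> w x0" and x = x])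
      fix w assume "w \<in> A"
      then have w: "w \<in> words" "ratio w \<le> R" "\<psi> w ` X \<inter> cball x R \<noteq> {}" by (auto simp: A_def)
      have "ratio w * D \<le> R * D" using w(2) D1 by (intro mult_right_mono) auto
      then show "dist x (\<psi> w x0) \<le> (1 + D) * R"
        using near[OF w(1) _ w(3)] by (simp add: algebra_simps)
    next
      fix v w assume "v \<in> A" "w \<in> A" "v \<noteq> w"
      then have vw: "v \<in> words" "w \<in> words" "\<rho>_min * R \<le> ratio v" by (auto simp: A_def)
      have "\<delta> * (\<rho>_min * R) \<le> \<delta> * ratio v" using vw(3) \<delta> by simp
      then show "\<delta> * \<rho>_min * R \<le> dist (\<psi> v x0) (\<psi> w x0)"
        using sep[OF x0 x0 vw(1,2) \<open>v \<noteq> w\<close>] by (simp add: mult.assoc)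
    qed
    define B1 where "B1 = {w\<in>B. ratio w \<le> 2 / \<delta> * R}"
    have B1: "finite B1 \<and> card B1 \<le> M2"
    proof (rule M2[rule_format, OF \<open>0 < R\<close>, where f = "\<lambda>w. \<psi> w x0" and x = x])
      fix w assume "w \<in> B1"
      then have w: "w \<in> words" "ratio w \<le> 2 / \<delta> * R" "\<psi> w ` P \<inter> cball x R \<noteq> {}"
        by (auto simp: B_def B1_def)
      have "ratio w * D \<le> 2 / \<delta> * R * D" using w(2) D1 by (intro mult_right_mono) auto
      moreover have "P \<subseteq> X \<union> C" using \<open>P \<subseteq> C\<close> by blast
      ultimately show "dist x (\<psi> w x0) \<le> (1 + 2 / \<delta> * D) * R"
        using near[OF w(1) _ w(3)] by (simp add: algebra_simps)
    next
      fix v w assume "v \<in> B1" "w \<in> B1" "v \<noteq> w"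
      then have vw: "v \<in> words" "w \<in> words" "R < ratio v" by (auto simp: B_def B1_def)
      have "\<delta> * R \<le> \<delta> * ratio v" using vw(3) \<delta> by simp
      then show "\<delta> * R \<le> dist (\<psi> v x0) (\<psi> w x0)"
        using sep[OF x0 x0 vw(1,2) \<open>v \<noteq> w\<close>] by simp
    qed
    have finB: "finite B"
      unfolding B_def by (rule finite_subset[OF _ finite_large_words[OF \<open>0 < R\<close>]]) auto
    \<comment> \<open>A copy of \<open>P\<close> much larger than \<open>R\<close> is so far from all other copies that the ball meets only one.\<close>
    have B2: "card (B - B1) \<le> Suc 0"
    proof (subst card_le_Suc0_iff_eq)
      show "\<forall>v\<in>B - B1. \<forall>w\<in>B - B1. v = w"
      proof (intro ballI, rule ccontr)
        fix v w assume *: "v \<in> B - B1" "w \<in> B - B1" "v \<noteq> w"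
        then have vw: "v \<in> words" "w \<in> words" "2 / \<delta> * R < ratio v"
          "\<psi> v ` P \<inter> cball x R \<noteq> {}" "\<psi> w ` P \<inter> cball x R \<noteq> {}"
          by (auto simp: B_def B1_def)
        obtain y z where yz: "y \<in> P" "z \<in> P" "dist x (\<psi> v y) \<le> R" "dist x (\<psi> w z) \<le> R"
          using vw(4,5) by auto
        have "dist (\<psi> v y) (\<psi> w z) \<le> 2 * R"
          using dist_triangle3[of "\<psi> v y" "\<psi> w z" x] yz by linarith
        moreover have "2 * R < \<delta> * ratio v" using vw(3) \<delta> by (simp add: field_simps)
        moreover have "\<delta> * ratio v \<le> dist (\<psi> v y) (\<psi> w z)"
          using yz \<open>P \<subseteq> C\<close> by (intro sep vw(1,2) *(3)) auto
        ultimately show False by linarith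
      qed
    qed (use finB in simp)
    have "card B = card B1 + card (B - B1)"
      using card_Diff_subset[of B1 B] card_mono[OF finB, of B1] B1 by (auto simp: B1_def)
    then have cardB: "card B \<le> M2 + 1" using B1 B2 by linarith
    have "coverable (\<psi> w ` X) r (K * (D powr s * (R / r) powr s))" if "w \<in> A" for w
    proof -
      have w: "w \<in> words" "ratio w \<le> R" using that by (auto simp: A_def)
      have rd: "r < R * D" using r mult_left_mono[OF D1, of R] by linarith
      then have t: "0 < r / (R * D)" "r / (R * D) < 1" using r \<open>0 < R\<close> D1 by auto
      have "D * (r / (R * D)) = r / R" using D1 by simp
      moreover have "(r / (R * D)) powr (- s) = D powr s * (R / r) powr s"
        using r \<open>0 < R\<close> D1 by (simp add: powr_minus powr_divide powr_mult field_simps)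
      ultimately have "coverable X (r / R) (K * (D powr s * (R / r) powr s))"
        using K(2)[rule_format, OF t] by simp
      then have "coverable (\<psi> w ` X) (ratio w * (r / R)) (K * (D powr s * (R / r) powr s))"
        by (rule coverable_image[OF _ dist_\<psi>[OF w(1)]]) (use ratio_pos[OF w(1)] in simp)
      moreover have "ratio w * (r / R) \<le> R * (r / R)"
        using w(2) r \<open>0 < R\<close> by (intro mult_right_mono) auto
      then have "ratio w * (r / R) \<le> r" using \<open>0 < R\<close> by simp
      ultimately show ?thesis by (rule coverable_mono[OF _ order_refl _ order_refl])
    qed
    then have cA: "coverable (\<Union>w\<in>A. \<psi> w ` X) r (\<Sum>w\<in>A. K * (D powr s * (R / r) powr s))"
      by (rule coverable_UN[OF conjunct1[OF A]])
    have "coverable (\<psi> v ` P \<inter> cball x R) r (c * (2 powr s * (R / r) powr s))" if "v \<in> B" for v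
    proof -
      have v: "v \<in> words" "\<psi> v ` P \<inter> cball x R \<noteq> {}" using that by (auto simp: B_def)
      have r0: "0 < ratio v" by (rule ratio_pos[OF v(1)])
      obtain y where y: "y \<in> P" "dist x (\<psi> v y) \<le> R" using v(2) by auto
      have "coverable (P \<inter> cball y (2 * R / ratio v)) (r / ratio v)
          (c * ((2 * R / ratio v) / (r / ratio v)) powr a)"
        using r r0 by (intro c(2)[OF y(1)] divide_strict_right_mono) auto
      moreover have "(2 * R / ratio v) / (r / ratio v) = 2 * (R / r)" using r0 by simp
      ultimately have "coverable (P \<inter> cball y (2 * R / ratio v)) (r / ratio v)
          (c * (2 * (R / r)) powr a)" by (simp only:)
      then have "coverable (\<psi> v ` (P \<inter> cball y (2 * R / ratio v))) (ratio v * (r / ratio v))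
          (c * (2 * (R / r)) powr a)"
        by (rule coverable_image[OF _ dist_\<psi>[OF v(1)]]) (use r0 in simp)
      moreover have "\<psi> v ` P \<inter> cball x R \<subseteq> \<psi> v ` (P \<inter> cball y (2 * R / ratio v))"
      proof
        fix z assume "z \<in> \<psi> v ` P \<inter> cball x R"
        then obtain z' where z: "z' \<in> P" "z = \<psi> v z'" "dist x (\<psi> v z') \<le> R" by auto
        have "ratio v * dist y z' \<le> 2 * R"
          using dist_triangle3[of "\<psi> v y" "\<psi> v z'" x] y(2) z(3) dist_\<psi>[OF v(1), of y z'] by linarith
        then have "dist y z' \<le> 2 * R / ratio v"
          using r0 by (simp add: pos_le_divide_eq mult.commute)
        then show "z \<in> \<psi> v ` (P \<inter> cball y (2 * R / ratio v))" using z by simp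
      qed
      moreover have "ratio v * (r / ratio v) \<le> r" using r0 by simp
      moreover have "c * (2 * (R / r)) powr a \<le> c * (2 powr s * (R / r) powr s)"
      proof -
        have "1 \<le> 2 * (R / r)" using r by (simp add: field_simps)
        then have "(2 * (R / r)) powr a \<le> (2 * (R / r)) powr s"
          using \<open>a \<le> s\<close> by (intro powr_mono)
        also have "\<dots> = 2 powr s * (R / r) powr s" using r powr_mult[of 2 "R / r" s] by simp
        finally show ?thesis using c(1) by simp
      qed
      ultimately show ?thesis by (rule coverable_mono)
    qed
    then have cB: "coverable (\<Union>v\<in>B. \<psi> v ` P \<inter> cball x R) r
        (\<Sum>v\<in>B. c * (2 powr s * (R / r) powr s))"
      by (rule coverable_UN[OF finB])
    have sub: "X \<inter> cball x R \<subseteq> (\<Union>w\<in>A. \<psi> w ` X) \<union> (\<Union>v\<in>B. \<psi> v ` P \<inter> cball x R)"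
    proof
      fix z assume z: "z \<in> X \<inter> cball x R"
      then have "z \<in> (\<Union>w\<in>{w\<in>words. \<rho>_min * R \<le> ratio w \<and> ratio w \<le> R}. \<psi> w ` X)
          \<union> (\<Union>w\<in>{w\<in>words. R < ratio w}. \<psi> w ` P)"
        using scale_decomposition[OF X' \<open>0 < R\<close> R] by blast
      then consider w where "w \<in> words" "\<rho>_min * R \<le> ratio w" "ratio w \<le> R" "z \<in> \<psi> w ` X"
        | w where "w \<in> words" "R < ratio w" "z \<in> \<psi> w ` P" by blast
      then show "z \<in> (\<Union>w\<in>A. \<psi> w ` X) \<union> (\<Union>v\<in>B. \<psi> v ` P \<inter> cball x R)"
      proof cases
        case 1
        then have "w \<in> A" using z unfolding A_def by blast
        then show ?thesis using 1(4) by blast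
      next
        case 2
        then have "w \<in> B" using z unfolding B_def by blast
        then show ?thesis using 2(3) z by blast
      qed
    qed
    have "(\<Sum>w\<in>A. K * (D powr s * (R / r) powr s)) + (\<Sum>v\<in>B. c * (2 powr s * (R / r) powr s))
        = real (card A) * (K * D powr s) * (R / r) powr s + real (card B) * (c * 2 powr s) * (R / r) powr s"
      by simp
    also have "\<dots> \<le> real M1 * (K * D powr s) * (R / r) powr s
        + real (M2 + 1) * (c * 2 powr s) * (R / r) powr s"
      using A cardB K(1) c(1) by (intro add_mono mult_right_mono) auto
    also have "\<dots> = (real M1 * (K * D powr s) + real (M2 + 1) * (c * 2 powr s)) * (R / r) powr s"
      by (simp add: algebra_simps)
    also have "\<dots> \<le> H * (R / r) powr s"
      unfolding H_def by (intro mult_right_mono) auto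
    finally show ?thesis
      by (rule coverable_mono[OF coverable_Un[OF cA cB] sub order_refl])
  qed
  have "1 \<le> H" by (simp add: H_def)
  show ?thesis
    by (rule covering_exponent_extend[OF \<open>compact X\<close> zero_less_one \<open>1 \<le> H\<close> \<open>0 \<le> s\<close>]) (rule loc)
qed

section \<open>Mass decay along generations\<close>

lemma ratio_le_1: "w \<in> words \<Longrightarrow> ratio w \<le> 1"
proof (induction w)
  case (Cons i w)
  then have "\<rho> i * ratio w \<le> 1 * 1"
    using \<rho>_less[of i] \<rho>_pos[of i] ratio_pos[of w] by (intro mult_mono) auto
  then show ?case by simp
qed simp

text \<open>For \<open>s \<le> 0\<close> a single summand is already at least 1.\<close>

lemma pressure_lt_1_pos:
  assumes "pressure s < 1"
  shows "0 < s"
proof (rule ccontr)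
  assume "\<not> 0 < s"
  then have "1 \<le> \<rho> 1 powr s"
    using \<rho>_pos[of 1] \<rho>_less[of 1] \<kappa>_pos powr_mono'[of s 0 "\<rho> 1"] by simp
  also have "\<dots> \<le> pressure s"
    unfolding pressure_def using \<kappa>_pos by (intro member_le_sum) auto
  finally show False using assms by simp
qed

lemma ex_pressure_lt_1: "\<exists>s. pressure s < 1"
proof -
  obtain n where n: "\<rho>_max ^ n < 1 / real \<kappa>"
    using real_arch_pow_inv[OF _ \<rho>_max(2), of "1 / real \<kappa>"] \<kappa>_pos by auto
  have "pressure (real n) \<le> (\<Sum>i\<in>{1..\<kappa>}. \<rho>_max ^ n)"
    unfolding pressure_def
  proof (rule sum_mono)
    fix i assume i: "i \<in> {1..\<kappa>}"
    then show "\<rho> i powr real n \<le> \<rho>_max ^ n"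
      using \<rho>_pos[OF i] \<rho>_max(3)[OF i] by (simp add: powr_realpow power_mono)
  qed
  also have "\<dots> = real \<kappa> * \<rho>_max ^ n" by simp
  also have "\<dots> < 1" using n \<kappa>_pos by (simp add: pos_less_divide_eq mult.commute)
  finally show ?thesis by blast
qed

text \<open>With \<epsilon> solving \<open>\<rho>_min powr \<epsilon> = 1 - \<eta> / 2\<close>,
  lowering the exponent by \<epsilon> multiplies each summand by at most
  \<open>1 / (1 - \<eta> / 2)\<close>, whatever \<open>t\<close> is.\<close>

lemma pressure_gap:
  assumes "0 < \<eta>" "\<eta> < 1"
  shows "\<exists>\<epsilon>>0. \<forall>t. pressure t \<le> 1 - \<eta> \<longrightarrow> pressure (t - \<epsilon>) < 1"
proof -
  define \<epsilon> where "\<epsilon> = ln (1 - \<eta> / 2) / ln \<rho>_min"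
  have ln: "ln \<rho>_min < 0" "ln (1 - \<eta> / 2) < 0" using \<rho>_min assms by auto
  then have "0 < \<epsilon>" unfolding \<epsilon>_def by (intro divide_neg_neg)
  have "\<rho>_min powr \<epsilon> = 1 - \<eta> / 2"
    using \<rho>_min(1) ln(1) assms by (simp add: powr_def \<epsilon>_def)
  have "pressure (t - \<epsilon>) < 1" if "pressure t \<le> 1 - \<eta>" for t
  proof -
    have "pressure (t - \<epsilon>) \<le> (\<Sum>i\<in>{1..\<kappa>}. \<rho> i powr t / (1 - \<eta> / 2))"
      unfolding pressure_def
    proof (rule sum_mono)
      fix i assume i: "i \<in> {1..\<kappa>}"
      have "\<rho>_min powr \<epsilon> \<le> \<rho> i powr \<epsilon>"
        using \<rho>_min(1) \<rho>_min(3)[OF i] \<open>0 < \<epsilon>\<close> by (intro powr_mono2) auto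
      then have "\<rho> i powr t / \<rho> i powr \<epsilon> \<le> \<rho> i powr t / (1 - \<eta> / 2)"
        using assms \<open>\<rho>_min powr \<epsilon> = 1 - \<eta> / 2\<close> by (intro divide_left_mono mult_pos_pos) auto
      then show "\<rho> i powr (t - \<epsilon>) \<le> \<rho> i powr t / (1 - \<eta> / 2)" by (simp add: powr_diff)
    qed
    also have "\<dots> = pressure t / (1 - \<eta> / 2)"
      by (simp add: pressure_def sum_divide_distrib)
    also have "\<dots> \<le> (1 - \<eta>) / (1 - \<eta> / 2)"
      using that assms by (intro divide_right_mono) auto
    also have "\<dots> < 1" using assms by (simp add: pos_divide_less_eq)
    finally show ?thesis .
  qed
  then show ?thesis using \<open>0 < \<epsilon>\<close> by blast
qed

text \<open>The number \<eta> is extracted from the one exponent \<open>t0\<close> and so serves all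
  \<open>t\<close> at once. The regularity constant of \<open>t\<close> enters only the prefactor
  \<beta>, which does not matter as the generation tends to infinity.\<close>

lemma lower_regular_pressure:
  fixes m :: "'a set \<Rightarrow> real"
  assumes X: "C \<subseteq> X" "\<And>i. i \<in> {1..\<kappa>} \<Longrightarrow> \<phi> i ` X \<subseteq> X" "0 < diameter X"
    and mono: "\<And>A B. A \<subseteq> B \<Longrightarrow> m A \<le> m B"
    and add: "\<And>A B. \<lbrakk>open A; A \<inter> B = {}\<rbrakk> \<Longrightarrow> m (A \<union> B) = m A + m B"
    and pos: "\<And>x r. \<lbrakk>x \<in> X; 0 < r\<rbrakk> \<Longrightarrow> 0 < m (cball x r)"
    and t0: "lower_regular m X t0"
  shows "\<exists>\<eta>. 0 < \<eta> \<and> \<eta> < 1 \<and> (\<forall>t. lower_regular m X t \<longrightarrow> pressure t \<le> 1 - \<eta>)"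
proof -
  obtain x0 where x0: "x0 \<in> C" using C_nonempty by auto
  obtain \<delta> where \<delta>: "0 < \<delta>" "\<forall>x\<in>C. cball x \<delta> \<subseteq> W"
    using inner_radius by (elim exE conjE)
  have x0U: "x0 \<in> U" using subsetD[OF order_trans[OF C_subset_W W_subset] x0] .
  obtain D0 where D0: "U \<subseteq> cball x0 D0"
    using bounded_U unfolding bounded_any_center[of U x0] by (auto simp only: subset_iff mem_cball)
  define D where "D = max D0 \<delta>"
  have D: "\<delta> \<le> D" "0 < D" using \<delta>(1) by (auto simp: D_def)
  have U_D: "dist x0 y \<le> D" if "y \<in> U" for y
    using subsetD[OF D0 that] by (simp add: D_def)
  define V where "V w = \<psi> w ` U" for w
  \<comment> \<open>Half the radius \<delta>, so that this closed ball fits into the image of the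
    open \<delta>-ball, hence into the gap of \<open>V w\<close>.\<close>
  define Z where "Z w = cball (\<psi> w x0) (ratio w * (\<delta> / 2))" for w
  have \<psi>_X: "\<psi> w y \<in> X" if "w \<in> words" "y \<in> X" for w y
    using that
  proof (induction w)
    case (Cons i w)
    then have i: "i \<in> {1..\<kappa>}" and "\<psi> w y \<in> X" by auto
    then have "\<phi> i (\<psi> w y) \<in> X" using X(2)[OF i] by (simp add: image_subset_iff)
    then show ?case by simp
  qed simp
  then have \<psi>_x0: "\<psi> w x0 \<in> X" if "w \<in> words" for w
    using that subsetD[OF X(1) x0] by simp
  have m0: "m {} = 0" using add[of "{}" "{}"] by simp
  have Z_W: "Z w \<subseteq> \<psi> w ` W" if w: "w \<in> words" for w
  proof -
    have "Z w \<subseteq> ball (\<psi> w x0) (ratio w * \<delta>)"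
      unfolding Z_def using \<delta>(1) ratio_pos[OF w] by (intro cball_subset_ball_iff[THEN iffD2]) auto
    also have "\<dots> \<subseteq> \<psi> w ` ball x0 \<delta>"
      by (rule similitude_ball_subset[OF dist_\<psi>[OF w] ratio_pos[OF w]])
    also have "\<dots> \<subseteq> \<psi> w ` W"
      using order_trans[OF ball_subset_cball bspec[OF \<delta>(2) x0]] by (rule image_mono)
    finally show ?thesis .
  qed
  have V_snoc: "V (w @ [i]) = \<psi> w ` (\<phi> i ` U)" for w i
    by (simp add: V_def word_map_append image_comp)
  have step: "(\<Sum>i\<in>{1..\<kappa>}. m (V (w @ [i]))) + m (Z w) \<le> m (V w)" if w: "w \<in> words" for w
  proof -
    have opn: "open (V (w @ [i]))" if "i \<in> {1..\<kappa>}" for i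
      unfolding V_def using open_\<psi>_U[of "w @ [i]"] w that by simp
    have disj: "V (w @ [i]) \<inter> V (w @ [j]) = {}" if "i \<in> {1..\<kappa>}" "j \<in> {1..\<kappa>}" "i \<noteq> j" for i j
      unfolding V_snoc image_Int[OF inj_\<psi>[OF w], symmetric] using \<phi>_disjoint[OF that] by simp
    have sum: "m (\<Union>i\<in>I. V (w @ [i])) = (\<Sum>i\<in>I. m (V (w @ [i])))" if "finite I" "I \<subseteq> {1..\<kappa>}" for I
      using that
    proof (induction I rule: finite_induct)
      case (insert i I)
      then have "V (w @ [i]) \<inter> V (w @ [j]) = {}" if "j \<in> I" for j
        using that by (intro disj) auto
      then have "V (w @ [i]) \<inter> (\<Union>j\<in>I. V (w @ [j])) = {}"
        by (simp add: Int_UN_distrib)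
      then have "m (V (w @ [i]) \<union> (\<Union>j\<in>I. V (w @ [j]))) = m (V (w @ [i])) + m (\<Union>j\<in>I. V (w @ [j]))"
        using insert.prems by (intro add opn) auto
      then show ?case using insert by simp
    qed (simp add: m0)
    have "(\<Union>i\<in>{1..\<kappa>}. V (w @ [i])) \<inter> Z w = {}"
    proof -
      have "V (w @ [i]) \<inter> \<psi> w ` W = {}" if "i \<in> {1..\<kappa>}" for i
        unfolding V_snoc image_Int[OF inj_\<psi>[OF w], symmetric] using W_disjoint[OF that]
        by (simp add: Int_commute)
      then have "V (w @ [i]) \<inter> Z w = {}" if "i \<in> {1..\<kappa>}" for i
        using Z_W[OF w] that by (meson disjoint_iff subsetD)
      then show ?thesis by (simp add: Int_UN_distrib Int_commute[of _ "Z w"])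
    qed
    moreover have "open (\<Union>i\<in>{1..\<kappa>}. V (w @ [i]))" by (intro open_UN ballI opn)
    ultimately have "m ((\<Union>i\<in>{1..\<kappa>}. V (w @ [i])) \<union> Z w) = (\<Sum>i\<in>{1..\<kappa>}. m (V (w @ [i]))) + m (Z w)"
      using add[of "\<Union>i\<in>{1..\<kappa>}. V (w @ [i])" "Z w"] sum[of "{1..\<kappa>}"] by simp
    moreover have "(\<Union>i\<in>{1..\<kappa>}. V (w @ [i])) \<subseteq> V w"
      unfolding V_snoc unfolding V_def by (intro UN_least image_mono \<phi>_U)
    moreover have "Z w \<subseteq> V w"
      unfolding V_def using Z_W[OF w] image_mono[OF W_subset, of "\<psi> w"] by (rule order_trans)
    ultimately show ?thesis using mono[of "(\<Union>i\<in>{1..\<kappa>}. V (w @ [i])) \<union> Z w" "V w"] by simp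
  qed
  have V_pos: "0 < m (V w)" if w: "w \<in> words" for w
  proof -
    have "0 < m (Z w)"
      unfolding Z_def using \<delta>(1) ratio_pos[OF w] by (intro pos \<psi>_x0[OF w]) simp
    moreover have "Z w \<subseteq> V w"
      unfolding V_def using Z_W[OF w] image_mono[OF W_subset, of "\<psi> w"] by (rule order_trans)
    then have "m (Z w) \<le> m (V w)" by (rule mono)
    ultimately show ?thesis by linarith
  qed
  obtain c0 where c0: "0 < c0" and reg0: "\<forall>x\<in>X. \<forall>r R. 0 < r \<and> r < R \<and> R < diameter X \<longrightarrow>
        c0 * (r / R) powr t0 * m (cball x R) \<le> m (cball x r)"
    using t0 unfolding lower_regular_def by (elim exE conjE)
  \<comment> \<open>The share of the mass of \<open>V w\<close> carried by \<open>Z w\<close>: the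
    radii \<open>ratio w * (\<delta> / 2)\<close> and \<open>ratio w * D\<close> have a quotient
    independent of \<open>w\<close>. The minimum keeps \<eta> below 1.\<close>
  define \<eta> where "\<eta> = min (1 / 2) (c0 * (\<delta> / 2 / D) powr t0)"
  have \<eta>: "0 < \<eta>" "\<eta> < 1" using c0 \<delta>(1) D by (auto simp: \<eta>_def)
  have decay: "(\<Sum>i\<in>{1..\<kappa>}. m (V (w @ [i]))) \<le> (1 - \<eta>) * m (V w)"
    if w: "w \<in> words" and small: "ratio w * D < diameter X" for w
  proof -
    have "V w \<subseteq> cball (\<psi> w x0) (ratio w * D)"
      unfolding V_def by (intro image_subsetI) (use dist_\<psi>[OF w] ratio_pos[OF w] U_D in simp)
    then have "m (V w) \<le> m (cball (\<psi> w x0) (ratio w * D))" by (rule mono)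
    then have "\<eta> * m (V w) \<le> c0 * (\<delta> / 2 / D) powr t0 * m (cball (\<psi> w x0) (ratio w * D))"
      using \<eta> V_pos[OF w] by (intro mult_mono) (auto simp: \<eta>_def)
    also have "\<delta> / 2 / D = (ratio w * (\<delta> / 2)) / (ratio w * D)" using ratio_pos[OF w] by simp
    also have "c0 * \<dots> powr t0 * m (cball (\<psi> w x0) (ratio w * D)) \<le> m (Z w)"
      unfolding Z_def
      using ratio_pos[OF w] \<delta>(1) D small \<psi>_x0[OF w] by (intro reg0[rule_format]) auto
    finally show ?thesis using step[OF w] by (simp add: algebra_simps)
  qed
  \<comment> \<open>Regularity only speaks of radii below the diameter of \<open>X\<close>, so
    everything is done below a long prefix \<open>w0\<close>. The factor 2 is for a ball that
    contains \<open>V w0\<close> although centred at an arbitrary descendant of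
    \<open>x0\<close>.\<close>
  obtain n0 where n0: "\<rho> 1 ^ n0 < diameter X / (2 * D)"
    using real_arch_pow_inv[of "diameter X / (2 * D)" "\<rho> 1"] X(3) D \<rho>_less[of 1] \<kappa>_pos by auto
  define w0 where "w0 = replicate n0 (1::nat)"
  have w0: "w0 \<in> words" using \<kappa>_pos by (auto simp: w0_def)
  have "ratio w0 = \<rho> 1 ^ n0" by (simp add: w0_def)
  then have r0: "ratio w0 * (2 * D) < diameter X"
    using n0 D by (simp add: pos_less_divide_eq)
  have r0_pos: "0 < ratio w0" by (rule ratio_pos[OF w0])
  have "pressure t \<le> 1 - \<eta>" if reg_t: "lower_regular m X t" for t
  proof (rule ccontr)
    obtain c where c: "0 < c" and reg: "\<forall>x\<in>X. \<forall>r R. 0 < r \<and> r < R \<and> R < diameter X \<longrightarrow>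
        c * (r / R) powr t * m (cball x R) \<le> m (cball x r)"
      using reg_t unfolding lower_regular_def by (elim exE conjE)
    define \<beta> where "\<beta> = c * (\<delta> / (4 * D)) powr t * m (V w0)"
    have \<beta>: "0 < \<beta>" using c \<delta>(1) D V_pos[OF w0] by (simp add: \<beta>_def)
    \<comment> \<open>Regularity is used once, from the scale of \<open>w0\<close> directly to that
      of \<open>w0 @ u\<close>; one use per letter would raise the constant \<open>c\<close> to the
      power of the length.\<close>
    have base: "\<beta> * ratio u powr t \<le> m (V (w0 @ u))" if u: "u \<in> words" for u
    proof -
      have v: "w0 @ u \<in> words" using u w0 by simp
      have ru: "0 < ratio u" "ratio u \<le> 1" using ratio_pos[OF u] ratio_le_1[OF u] by auto
      have "V w0 \<subseteq> cball (\<psi> (w0 @ u) x0) (ratio w0 * (2 * D))"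
      proof
        fix y assume "y \<in> V w0"
        then obtain z where z: "z \<in> U" "y = \<psi> w0 z" by (auto simp: V_def)
        have "\<psi> u x0 \<in> U" using \<psi>_U[OF u] x0U by blast
        then have "dist (\<psi> u x0) z \<le> 2 * D"
          using U_D[of "\<psi> u x0"] U_D[OF z(1)] dist_triangle3[of "\<psi> u x0" z x0] by linarith
        then show "y \<in> cball (\<psi> (w0 @ u) x0) (ratio w0 * (2 * D))"
          using r0_pos z(2) by (simp add: word_map_append dist_\<psi>[OF w0])
      qed
      then have m_le: "m (V w0) \<le> m (cball (\<psi> (w0 @ u) x0) (ratio w0 * (2 * D)))" by (rule mono)
      have powr_eq: "(\<delta> / (4 * D)) powr t * ratio u powr t = ((ratio u * (\<delta> / 2)) / (2 * D)) powr t"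
      proof -
        have "(\<delta> / (4 * D) * ratio u) powr t = (\<delta> / (4 * D)) powr t * ratio u powr t"
          using \<delta>(1) D ru by (intro powr_mult)
        then show ?thesis by (simp add: mult.commute)
      qed
      have "\<beta> * ratio u powr t = c * ((\<delta> / (4 * D)) powr t * ratio u powr t) * m (V w0)"
        by (simp add: \<beta>_def)
      also have "\<dots> \<le> c * ((ratio u * (\<delta> / 2)) / (2 * D)) powr t * m (cball (\<psi> (w0 @ u) x0) (ratio w0 * (2 * D)))"
        unfolding powr_eq using c m_le by (intro mult_left_mono) auto
      also have "(ratio u * (\<delta> / 2)) / (2 * D) = (ratio (w0 @ u) * (\<delta> / 2)) / (ratio w0 * (2 * D))"
        using r0_pos by simp
      also have "c * \<dots> powr t * m (cball (\<psi> (w0 @ u) x0) (ratio w0 * (2 * D))) \<le> m (Z (w0 @ u))"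
        unfolding Z_def
      proof (intro reg[rule_format] conjI r0 \<psi>_x0 v)
        show "0 < ratio (w0 @ u) * (\<delta> / 2)" using ratio_pos[OF v] \<delta>(1) by simp
        have "ratio u * (\<delta> / 2) \<le> 1 * (\<delta> / 2)" using ru \<delta>(1) by (intro mult_right_mono) auto
        then have "ratio u * (\<delta> / 2) < 2 * D" using D \<delta>(1) by linarith
        then show "ratio (w0 @ u) * (\<delta> / 2) < ratio w0 * (2 * D)"
          using mult_strict_left_mono[OF _ r0_pos] by (simp add: mult.assoc)
      qed
      also have "m (Z (w0 @ u)) \<le> m (V (w0 @ u))"
        unfolding V_def
        by (rule mono) (rule order_trans[OF Z_W[OF v] image_mono[OF W_subset]])
      finally show ?thesis .
    qed
    \<comment> \<open>Sum the estimate over the children of \<open>u\<close> and apply the decay at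
      \<open>w0 @ u\<close>. The empty \<open>u\<close> then compares the powers of
      \<open>pressure t\<close> and \<open>1 - \<eta>\<close>.\<close>
    have power: "\<beta> * ratio u powr t * pressure t ^ n \<le> (1 - \<eta>) ^ n * m (V (w0 @ u))"
      if "u \<in> words" for n u
      using that
    proof (induction n arbitrary: u)
      case 0
      then show ?case using base by simp
    next
      case (Suc n)
      have "\<beta> * ratio u powr t * pressure t ^ Suc n
          = (\<Sum>i\<in>{1..\<kappa>}. \<beta> * ratio (u @ [i]) powr t * pressure t ^ n)"
      proof -
        have "ratio (u @ [i]) powr t = ratio u powr t * \<rho> i powr t" if "i \<in> {1..\<kappa>}" for i
          using \<rho>_pos[OF that] ratio_pos[OF Suc.prems] by (simp add: powr_mult)
        then have "(\<Sum>i\<in>{1..\<kappa>}. \<beta> * ratio (u @ [i]) powr t * pressure t ^ n)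
            = (\<Sum>i\<in>{1..\<kappa>}. (\<beta> * ratio u powr t * pressure t ^ n) * \<rho> i powr t)"
          by (intro sum.cong refl) simp
        also have "\<dots> = (\<beta> * ratio u powr t * pressure t ^ n) * pressure t"
          unfolding pressure_def sum_distrib_left[symmetric] ..
        finally show ?thesis by simp
      qed
      also have "\<dots> \<le> (\<Sum>i\<in>{1..\<kappa>}. (1 - \<eta>) ^ n * m (V (w0 @ (u @ [i]))))"
        using Suc.prems by (intro sum_mono Suc.IH) simp
      also have "\<dots> = (1 - \<eta>) ^ n * (\<Sum>i\<in>{1..\<kappa>}. m (V ((w0 @ u) @ [i])))"
        by (simp add: sum_distrib_left)
      also have "\<dots> \<le> (1 - \<eta>) ^ n * ((1 - \<eta>) * m (V (w0 @ u)))"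
      proof (intro mult_left_mono decay)
        show "w0 @ u \<in> words" using w0 Suc.prems by simp
        have "ratio w0 * ratio u * D \<le> ratio w0 * 1 * (2 * D)"
          using r0_pos ratio_pos[OF Suc.prems] ratio_le_1[OF Suc.prems] D by (intro mult_mono) auto
        then show "ratio (w0 @ u) * D < diameter X" using r0 by simp
      qed (use \<eta> in auto)
      finally show ?case by (simp add: mult_ac)
    qed
    assume "\<not> pressure t \<le> 1 - \<eta>"
    then have "1 < pressure t / (1 - \<eta>)" using \<eta> by (simp add: pos_less_divide_eq)
    then obtain n where "m (V w0) / \<beta> < (pressure t / (1 - \<eta>)) ^ n"
      using real_arch_pow by blast
    then have "m (V w0) * (1 - \<eta>) ^ n < \<beta> * pressure t ^ n"
      using \<beta> \<eta> by (simp add: power_divide field_simps)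
    then show False using power[of "[]" n] by (simp add: mult.commute)
  qed
  then show ?thesis using \<eta> by blast
qed

section \<open>Comparison of the dimensions\<close>

lemma upper_assouad_dim_self_similar_le:
  assumes "self_similar_set \<kappa> \<phi> E" "pressure s < 1"
  shows "upper_assouad_dim E \<le> ereal s"
proof (rule upper_assouad_dim_le)
  show "0 \<le> s" using pressure_lt_1_pos[OF assms(2)] by simp
  have "covering_exponent {} s" by (auto simp: covering_exponent_def)
  then show "covering_exponent E s"
    using assms \<open>0 \<le> s\<close>
    by (intro attractor_covering_exponent[of E "{}" s s]) (simp_all add: self_similar_set_def)
qed

lemma upper_assouad_dim_inhomogeneous_le:
  assumes "inhomogeneous_self_similar_set \<kappa> \<phi> C X" "pressure s < 1"
    and "upper_assouad_dim C < ereal s"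
  shows "upper_assouad_dim X \<le> ereal s"
proof (rule upper_assouad_dim_le)
  show "0 \<le> s" using pressure_lt_1_pos[OF assms(2)] by simp
  obtain a where "0 \<le> a" "a < s" "covering_exponent C a"
    using upper_assouad_dim_less_imp[OF compact_C assms(3)] .
  then show "covering_exponent X s"
    using assms(1,2) \<open>0 \<le> s\<close>
    by (intro attractor_covering_exponent[of X C a s]) (simp_all add: inhomogeneous_self_similar_set_def)
qed

lemma upper_assouad_dim_less_upper_regularity_dim:
  assumes E: "self_similar_set \<kappa> \<phi> E" and X: "inhomogeneous_self_similar_set \<kappa> \<phi> C X"
    and less: "upper_assouad_dim C < upper_assouad_dim E"
    and mu: "measure_supported_on X \<mu>"
  shows "upper_assouad_dim X < upper_regularity_dim X \<mu>"
proof -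
  \<comment> \<open>Here the hypothesis on dimensions enters: \<open>pressure s < 1\<close> bounds
    the dimension of \<open>E\<close> by \<open>s\<close>, so that of \<open>C\<close> is strictly
    below \<open>s\<close>.\<close>
  have dim: "upper_assouad_dim X \<le> ereal s" if "pressure s < 1" for s
    using upper_assouad_dim_inhomogeneous_le[OF X that]
      less_le_trans[OF less upper_assouad_dim_self_similar_le[OF E that]] by simp
  have on: "measure_on X \<mu>" using mu by (simp add: measure_supported_on_def)
  have "compact X" and X_eq: "X = (\<Union>i\<in>{1..\<kappa>}. \<phi> i ` X) \<union> C"
    using X by (simp_all add: inhomogeneous_self_similar_set_def)
  then have bdd: "bounded X" by (simp add: compact_imp_bounded)
  have CX: "C \<subseteq> X" using X_eq by blast
  have \<phi>X: "\<phi> i ` X \<subseteq> X" if "i \<in> {1..\<kappa>}" for i using X_eq that by blast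
  obtain x0 where x0: "x0 \<in> C" using C_nonempty by auto
  have "x0 \<in> X" using CX x0 by blast
  have "\<phi> 1 x0 \<in> X" using \<phi>X[of 1] \<kappa>_pos \<open>x0 \<in> X\<close> by auto
  \<comment> \<open>The point \<open>x0\<close> of the gap and its image under
    \<open>\<phi> 1\<close> are distinct, so \<open>X\<close> has positive diameter.\<close>
  have "x0 \<in> W" "x0 \<in> U" using x0 C_subset_W W_subset by (meson subsetD)+
  then have "x0 \<noteq> \<phi> 1 x0" using W_disjoint[of 1] \<kappa>_pos by auto
  then have diam: "0 < diameter X"
    using diameter_bounded_bound[OF bdd \<open>x0 \<in> X\<close> \<open>\<phi> 1 x0 \<in> X\<close>] zero_less_dist_iff[of x0 "\<phi> 1 x0"]
    by linarith
  define m where "m = (\<lambda>A. enn2real (\<mu> (X \<inter> A)))"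
  have mono: "m A \<le> m B" if "A \<subseteq> B" for A B
    unfolding m_def by (rule measure_on_mono[OF on bdd that])
  have add: "m (A \<union> B) = m A + m B" if "open A" "A \<inter> B = {}" for A B
    unfolding m_def by (rule measure_on_additive[OF on bdd that])
  have pos: "0 < m (cball x r)" if "x \<in> X" "0 < r" for x r
    using mu that measure_on_finite[OF on bdd, of "cball x r"]
    by (simp add: m_def measure_supported_on_def enn2real_positive_iff)
  show ?thesis
  proof (cases "\<exists>t. lower_regular m X t")
    case True
    then obtain t0 where "lower_regular m X t0" by blast
    then obtain \<eta> where "0 < \<eta>" "\<eta> < 1"
      and gap: "\<forall>t. lower_regular m X t \<longrightarrow> pressure t \<le> 1 - \<eta>"
      using lower_regular_pressure[OF CX \<phi>X diam mono add pos] by metis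
    then obtain \<epsilon> where \<epsilon>: "0 < \<epsilon>" "\<forall>t. pressure t \<le> 1 - \<eta> \<longrightarrow> pressure (t - \<epsilon>) < 1"
      using pressure_gap by metis
    define T where "T = {t. lower_regular m X t}"
    have T: "pressure (t - \<epsilon>) < 1" if "t \<in> T" for t using that gap \<epsilon>(2) by (simp add: T_def)
    have "bdd_below T"
      by (rule bdd_belowI[of _ 0]) (use T pressure_lt_1_pos \<epsilon>(1) in force)
    moreover have "T \<noteq> {}" using True by (auto simp: T_def)
    \<comment> \<open>Taking \<open>t\<close> within \<epsilon> of the infimum of the regularity
      exponents puts \<open>t - \<epsilon>\<close> strictly below that infimum, while
      \<open>t - \<epsilon>\<close> still bounds the dimension of \<open>X\<close>.\<close>
    ultimately obtain t where t: "t \<in> T" "t < Inf T + \<epsilon>"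
      using cInf_lessD[of T "Inf T + \<epsilon>"] \<epsilon>(1) by auto
    have "upper_assouad_dim X \<le> ereal (t - \<epsilon>)" using dim T[OF t(1)] .
    also have "\<dots> < ereal (Inf T)" using t(2) by simp
    also have "\<dots> \<le> upper_regularity_dim X \<mu>"
      using cInf_lower[OF _ \<open>bdd_below T\<close>]
      by (intro upper_regularity_dim_ge[OF mu bdd]) (simp add: T_def m_def)
    finally show ?thesis .
  next
    case False
    obtain s where "pressure s < 1" using ex_pressure_lt_1 by blast
    then have "upper_assouad_dim X \<le> ereal s" by (rule dim)
    also have "\<dots> < ereal (s + 1)" by simp
    also have "\<dots> \<le> upper_regularity_dim X \<mu>"
      using False by (intro upper_regularity_dim_ge[OF mu bdd]) (simp add: m_def)
    finally show ?thesis .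
  qed
qed

end

section \<open>Reduction to a bounded open set\<close>

lemma cosc_ifs_exists:
  fixes C :: "'a::euclidean_space set"
  assumes "compact C" "C \<noteq> {}" "1 \<le> \<kappa>" and ifs: "similitude_ifs \<kappa> \<phi>"
    and cosc: "condensation_open_set_condition \<kappa> \<phi> C"
  shows "\<exists>\<rho> U. cosc_ifs \<kappa> \<phi> \<rho> C U"
proof -
  have "\<forall>i\<in>{1..\<kappa>}. \<exists>\<rho>. 0 < \<rho> \<and> \<rho> < 1 \<and> (\<forall>x y. dist (\<phi> i x) (\<phi> i y) = \<rho> * dist x y)"
    using ifs by (simp add: similitude_ifs_def contractive_similitude_def)
  then obtain \<rho> where \<rho>: "\<forall>i\<in>{1..\<kappa>}. 0 < \<rho> i \<and> \<rho> i < 1 \<and>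
      (\<forall>x y. dist (\<phi> i x) (\<phi> i y) = \<rho> i * dist x y)"
    by (rule bchoice[THEN exE])
  obtain U where U: "open U" "C \<subseteq> U - (\<Union>i\<in>{1..\<kappa>}. closure (\<phi> i ` U))"
    "\<forall>i\<in>{1..\<kappa>}. \<phi> i ` U \<subseteq> U"
    "\<forall>i\<in>{1..\<kappa>}. \<forall>j\<in>{1..\<kappa>}. i \<noteq> j \<longrightarrow> \<phi> i ` U \<inter> \<phi> j ` U = {}"
    using cosc unfolding condensation_open_set_condition_def by (elim exE conjE)
  obtain b where b: "\<forall>x\<in>C. norm x \<le> b" "0 < b"
    using \<open>compact C\<close> compact_imp_bounded bounded_pos by metis
  \<comment> \<open>The ball of radius \<open>M\<close> about 0 is invariant under
    \<open>\<phi> i\<close> once \<open>norm (\<phi> i 0) < M * (1 - \<rho> i)\<close>; the sum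
    dominates all these thresholds at once, and \<open>b\<close> keeps \<open>C\<close>
    inside.\<close>
  define M where "M = (\<Sum>i\<in>{1..\<kappa>}. norm (\<phi> i 0) / (1 - \<rho> i)) + b + 1"
  define U' where "U' = U \<inter> ball 0 M"
  have nonneg: "0 \<le> norm (\<phi> i 0) / (1 - \<rho> i)" if "i \<in> {1..\<kappa>}" for i
    using \<rho> that by (intro divide_nonneg_pos) auto
  then have bM: "b < M" using sum_nonneg[of "{1..\<kappa>}" "\<lambda>i. norm (\<phi> i 0) / (1 - \<rho> i)"]
    by (simp add: M_def)
  \<comment> \<open>A large ball is mapped into itself by every map, so the open set may be taken bounded.\<close>
  have ball: "norm (\<phi> i y) < M" if i: "i \<in> {1..\<kappa>}" and y: "norm y < M" for i y
  proof -
    have \<rho>i: "0 < \<rho> i" "\<rho> i < 1" "dist (\<phi> i y) (\<phi> i 0) = \<rho> i * dist y 0" using \<rho> i by auto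
    have "norm (\<phi> i 0) / (1 - \<rho> i) \<le> (\<Sum>i\<in>{1..\<kappa>}. norm (\<phi> i 0) / (1 - \<rho> i))"
      using i nonneg by (intro member_le_sum) auto
    then have "norm (\<phi> i 0) / (1 - \<rho> i) < M" using b(2) by (simp add: M_def)
    then have "norm (\<phi> i 0) < M * (1 - \<rho> i)" using \<rho>i by (simp add: pos_divide_less_eq)
    moreover have "norm (\<phi> i y) \<le> \<rho> i * norm y + norm (\<phi> i 0)"
      using norm_triangle_sub[of "\<phi> i y" "\<phi> i 0"] \<rho>i(3) by (simp add: dist_norm)
    moreover have "\<rho> i * norm y \<le> \<rho> i * M" using y \<rho>i by simp
    ultimately show ?thesis by (simp add: algebra_simps)
  qed
  have "cosc_ifs \<kappa> \<phi> \<rho> C U'"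
  proof
    show "open U'" "bounded U'" using U(1) by (auto simp: U'_def intro: bounded_subset)
    have "C \<subseteq> U'"
      using U(2) b(1) bM by (fastforce simp: U'_def)
    moreover have "closure (\<phi> i ` U') \<subseteq> closure (\<phi> i ` U)" for i
      by (intro closure_mono image_mono) (simp add: U'_def)
    ultimately show "C \<subseteq> U' - (\<Union>i\<in>{1..\<kappa>}. closure (\<phi> i ` U'))"
      using U(2) by blast
    show "\<phi> i ` U' \<subseteq> U'" if "i \<in> {1..\<kappa>}" for i
      using bspec[OF U(3) that] ball[OF that] by (auto simp: U'_def)
    show "\<phi> i ` U' \<inter> \<phi> j ` U' = {}" if "i \<in> {1..\<kappa>}" "j \<in> {1..\<kappa>}" "i \<noteq> j" for i j
    proof -
      have "\<phi> i ` U \<inter> \<phi> j ` U = {}" using U(4) that by blast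
      then show ?thesis by (auto simp: U'_def)
    qed
  qed (use assms(1-3) \<rho> in auto)
  then show ?thesis by blast
qed

theorem theorem5p1:
  fixes C E E\<^sub>C :: "(real ^ 'd) set"
    and \<phi> :: "nat \<Rightarrow> real ^ 'd \<Rightarrow> real ^ 'd"
    and \<kappa> :: nat
  assumes "compact C" and "C \<noteq> {}"
    and "similitude_ifs \<kappa> \<phi>"
    and "condensation_open_set_condition \<kappa> \<phi> C"
    and "self_similar_set \<kappa> \<phi> E"
    and "inhomogeneous_self_similar_set \<kappa> \<phi> C E\<^sub>C"
    and "upper_assouad_dim C < upper_assouad_dim E"
  shows "\<forall>\<mu>. measure_supported_on E\<^sub>C \<mu> \<longrightarrow>
           upper_assouad_dim E\<^sub>C < upper_regularity_dim E\<^sub>C \<mu>"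
proof -
  \<comment> \<open>An empty system would make the self-similar set empty.\<close>
  have "1 \<le> \<kappa>"
    using assms(5) by (cases "\<kappa> = 0") (auto simp: self_similar_set_def)
  then obtain \<rho> U where "cosc_ifs \<kappa> \<phi> \<rho> C U"
    using cosc_ifs_exists[OF assms(1,2) _ assms(3,4)] by blast
  then show ?thesis
    using cosc_ifs.upper_assouad_dim_less_upper_regularity_dim[OF _ assms(5-7)] by blast
qed

end
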